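(* Let $q=p^l>2$ be a prime power, let $n\ge1$, $r\ge2$, and $m\ge0$ integers with $p^m\le q$, and let $N_0,\dots,N_{n-1}$ be nonnegative integers with $1\le\sum_{i=0}^{n-1}N_i\le q-1$. Put $s_1=q^n-\sum_{i=0}^{n-1}N_iq^i$ and suppose $(q-1)s_1\le p^m(q-1)q^{n-1}$. Then $$\zeta_A\bigl(s_1,\;p^m(q-1)q^{n-1},\;p^m(q-1)q^{n},\dots,\;p^m(q-1)q^{n+r-3}\bigr)$$ is zeta-like. Moreover, if $q-1$ does not divide $s_1$, then, with $w=p^mq^{n+r-2}-p^mq^{n-1}+s_1$, $N_i'=N_i$ for $0\le i\le n-2$ and $N_{n-1}'=N_{n-1}-(q-p^m)$, $$\zeta_A\bigl(s_1,p^m(q-1)q^{n-1},\dots,p^m(q-1)q^{n+r-3}\bigr)=\frac{(-1)^{(r-1)(1+\sum_i N_i)}\prod_{i=0}^{n-1}L_{n+r-2-i}^{N_i'q^i}}{\prod_{k=1}^{r-1}[k]^{p^mq^{n+r-2-k}}\;\prod_{i=0}^{n-2}L_{n-1-i}^{N_iq^i}}\;\zeta_A(w).$$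
   Context: $A=\mathbb{F}_q[\theta]$, $A_+$ the monic polynomials, $K=\mathbb{F}_q(\theta)$, $[k]=\theta^{q^k}-\theta$, $L_k=[k][k-1]\cdots[1]$. For $s\in\mathbb{Z}$, $d\ge0$ let $S_d(s)=\sum_{a\in A_+,\deg a=d}a^{-s}$. For positive integers $s_1,\dots,s_r$, $\zeta_A(s_1,\dots,s_r)=\sum_{d_1>\cdots>d_r\ge0}S_{d_1}(s_1)\cdots S_{d_r}(s_r)$, and $\zeta_A(k)=\sum_{a\in A_+}a^{-k}$. A multizeta value of weight $w=\sum s_i$ is zeta-like if $\zeta_A(s_1,\dots,s_r)/\zeta_A(w)\in K$. Empty products are $1$. *)

theory Defs
  imports
    "HOL-Analysis.Infinite_Sum"
    "HOL-Library.Cardinality"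
    "HOL-Computational_Algebra.Formal_Laurent_Series"
    "HOL-Computational_Algebra.Polynomial"
    "HOL-Computational_Algebra.Primes"
begin

text \<open>
  The finite field with \<open>q\<close> elements is a type \<open>'a :: {field, finite}\<close> with \<open>CARD('a) = q\<close>, and
  \<open>A\<close> is \<open>'a poly\<close>. All values live in the completion of \<open>K\<close> at the infinite place, the field of
  Laurent series in \<open>1/\<theta>\<close>, which is \<open>'a fls\<close> with the library's metric; its indeterminate
  \<^const>\<open>fls_X\<close> is \<open>1/\<theta>\<close>, so that \<open>\<theta>\<close> is \<^const>\<open>fls_X_inv\<close>.
\<close>

definition theta :: "'a::field fls" where
  "theta = fls_X_inv"

definition emb :: "'a::field poly \<Rightarrow> 'a fls" where
  "emb a = poly (map_poly fls_const a) theta"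

definition K_field :: "'a::field fls set" where
  "K_field = {emb a / emb b | a b. b \<noteq> 0}"

definition monics :: "'a::field poly set" where
  "monics = {a. lead_coeff a = 1}"

definition bracket :: "nat \<Rightarrow> 'a::{field,finite} fls" where
  "bracket k = theta ^ (CARD('a) ^ k) - theta"

definition L :: "nat \<Rightarrow> 'a::{field,finite} fls" where
  "L k = (\<Prod>j=1..k. bracket j)"

definition S :: "nat \<Rightarrow> int \<Rightarrow> 'a::{field,finite} fls" where
  "S d s = (\<Sum>a\<in>{a \<in> monics. degree a = d}. emb a powi (- s))"

definition zeta :: "int \<Rightarrow> 'a::{field,finite} fls" where
  "zeta k = (\<Sum>\<^sub>\<infinity>a\<in>monics. emb a powi (- k))"

definition multizeta :: "int list \<Rightarrow> 'a::{field,finite} fls" where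
  "multizeta ss =
    (\<Sum>\<^sub>\<infinity>ds\<in>{ds. length ds = length ss \<and> sorted_wrt (>) ds}.
       \<Prod>i<length ss. S (ds ! i) (ss ! i))"

text \<open>
  Being zeta-like refers to the weight, hence it is a property of the tuple; the otherwise
  unconstrained field of constants is passed as a type argument.
\<close>

definition zeta_like :: "'a::{field,finite} itself \<Rightarrow> int list \<Rightarrow> bool" where
  "zeta_like _ ss \<longleftrightarrow> (multizeta ss :: 'a fls) / zeta (sum_list ss) \<in> K_field"

end

theory Submission
  imports Defs
begin

text \<open>
  Let \<open>ell d = (\<theta> - \<theta>^q) \<cdots> (\<theta> - \<theta>^(q^d))\<close>. Lagrange interpolation at the points \<open>\<theta>^(q^(n + j))\<close>, \<open>j < d\<close>,
  writes \<open>a^(q^i)\<close> for \<open>i < n\<close> and \<open>a\<close> monic of degree \<open>d\<close> as a constant independent of \<open>a\<close> plus a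
  combination of the powers \<open>a^(q^(n + j))\<close>. A sum of products of fewer than \<open>d (q - 1)\<close> linear forms over the
  monic polynomials of degree \<open>d\<close> vanishes, so only the constants survive, and
  \<open>S d (q^n - \<Sum>i. N i q^i)\<close> becomes a product of powers of values of \<open>ell\<close>. The inner sums of the
  multizeta value telescope to \<open>(c * ell d / ell (d - k)^(q^k))^(p^m q^(n - 1))\<close> with \<open>k = r - 1\<close>.
  Multiplying, the term with \<open>d + k\<close> as largest degree is a fixed element of \<open>K\<close> times \<open>S d w\<close>. Here
  the bound on \<open>s1\<close> says precisely that \<open>N (n - 1) \<ge> q - p^m\<close>, so the digits of \<open>w\<close> are again admissible.
\<close>

unbundle fps_syntax

subsection \<open>Finite fields\<close>

text \<open>Translation by 1 permutes the field, so the sum of all elements equals itself plus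
  \<open>CARD('a)\<close> copies of 1.\<close>

lemma of_nat_CARD_eq_0: "of_nat CARD('a::{field,finite}) = (0::'a)"
proof -
  have "(\<Sum>x\<in>UNIV. x) = (\<Sum>x\<in>UNIV. x + (1::'a))"
    by (rule sum.reindex_bij_witness[of _ "\<lambda>x. x + 1" "\<lambda>x. x - 1"]) auto
  then show ?thesis by (simp add: sum.distrib)
qed

lemma finite_field_prime_CHAR: "prime CHAR('a::{field,finite})"
  using prime_CHAR_semidom finite_imp_CHAR_pos[OF finite_class.finite_UNIV] by blast

lemma CARD_gt_1: "CARD('a::{field,finite}) > 1"
  using card_gt_0_iff[of "UNIV :: 'a set"] card_mono[of UNIV "{0,1::'a}"] by simp

lemma power_CARD_eq: "(x::'a::{field,finite}) ^ CARD('a) = x"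
proof (cases "x = 0")
  case False
  have "(\<Prod>y\<in>UNIV-{0}. y) = (\<Prod>y\<in>UNIV-{0}. x * y)"
    by (rule prod.reindex_bij_witness[of _ "\<lambda>y. x * y" "\<lambda>y. y / x"]) (use False in auto)
  also have "\<dots> = x ^ (CARD('a) - 1) * (\<Prod>y\<in>UNIV-{0}. y)"
    by (simp add: prod.distrib)
  finally have "x ^ (CARD('a) - 1) = 1" by simp
  then show ?thesis by (subst power_eq_if) simp
qed simp

text \<open>For \<open>j > 0\<close>, scaling by a nonzero \<open>g\<close> permutes the field and
  multiplies the sum by \<open>g^j\<close>; as \<open>X^j - 1\<close> has at most
  \<open>j < q - 1\<close> roots, some \<open>g\<close> has \<open>g^j \<noteq> 1\<close>. For
  \<open>j = 0\<close> the convention \<open>0^0 = 1\<close> gives \<open>q\<close> copies of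
  1.\<close>

lemma sum_power_eq_0:
  assumes "j < CARD('a::{field,finite}) - 1"
  shows "(\<Sum>c\<in>UNIV. (c::'a) ^ j) = 0"
proof (cases "j = 0")
  case True
  then show ?thesis by (simp add: of_nat_CARD_eq_0)
next
  case False
  obtain g :: 'a where g: "g \<noteq> 0" "g ^ j \<noteq> 1"
  proof (rule ccontr)
    assume "\<not> thesis"
    then have *: "g ^ j = 1" if "g \<noteq> 0" for g :: 'a using that \<open>\<And>g. \<lbrakk>g \<noteq> 0; g ^ j \<noteq> 1\<rbrakk> \<Longrightarrow> thesis\<close> by blast
    define P :: "'a poly" where "P = monom 1 j - 1"
    have "coeff P j = 1" using False by (simp add: P_def)
    then have "P \<noteq> 0" by auto
    have "degree P \<le> j" unfolding P_def by (intro degree_diff_le) (auto simp: degree_monom_le)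
    have "card (UNIV - {0::'a}) \<le> card {x. poly P x = 0}"
      by (intro card_mono) (auto simp: P_def poly_monom * )
    also have "\<dots> \<le> degree P" using \<open>P \<noteq> 0\<close> by (rule card_poly_roots_bound)
    finally show False using assms \<open>degree P \<le> j\<close> by (simp add: card_Diff_singleton)
  qed
  have "(\<Sum>c\<in>UNIV. c ^ j) = (\<Sum>c\<in>UNIV. (g * c) ^ j)"
    by (rule sum.reindex_bij_witness[of _ "\<lambda>y. g * y" "\<lambda>y. y / g"]) (use g in auto)
  also have "\<dots> = g ^ j * (\<Sum>c\<in>UNIV. c ^ j)"
    by (simp add: power_mult_distrib sum_distrib_left)
  finally show ?thesis using g by simp
qed

subsection \<open>The embedding of A\<close>

lemma emb_0 [simp]: "emb 0 = 0"
  by (simp add: emb_def)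

lemma emb_pCons [simp]: "emb (pCons c a) = fls_const c + theta * emb a"
  by (simp add: emb_def map_poly_pCons)

lemma emb_1 [simp]: "emb 1 = 1"
  by (simp add: one_pCons)

lemma emb_add: "emb (a + b) = emb a + emb b"
  by (induction a b rule: poly_induct2) (auto simp: algebra_simps simp flip: fls_plus_const)

lemma emb_smult: "emb (smult c a) = fls_const c * emb a"
  by (induction a) (auto simp: algebra_simps simp flip: fls_const_mult_const)

lemma emb_mult: "emb (a * b) = emb a * emb b"
  by (induction a) (auto simp: emb_add emb_smult algebra_simps)

lemma emb_uminus: "emb (- a) = - emb a"
  using emb_smult[of "-1" a] by simp

lemma emb_diff: "emb (a - b) = emb a - emb b"
  using emb_add[of a "- b"] by (simp add: emb_uminus)

lemma emb_power: "emb (a ^ n) = emb a ^ n"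
  by (induction n) (auto simp: emb_mult)

text \<open>The indeterminate is \<open>1/theta\<close>, so the coefficient of
  \<open>theta^i\<close> sits at index \<open>- i\<close>. Injectivity of \<open>emb\<close> and the
  valuation \<open>- degree a\<close> follow.\<close>

lemma emb_nth: "emb a $$ k = (if k \<le> 0 then coeff a (nat (- k)) else 0)"
proof (induction a arbitrary: k)
  case 0
  then show ?case by simp
next
  case (pCons c a)
  have "nat (- k) = Suc (nat (- k - 1))" if "k < 0" using that by simp
  then show ?case
    by (auto simp: theta_def fls_X_inv_times_conv_shift pCons.IH coeff_pCons nat_diff_distrib split: nat.split)
qed

lemma emb_eq_0_iff [simp]: "emb a = 0 \<longleftrightarrow> a = 0"
proof
  assume "emb a = 0"
  then have "coeff a k = 0" for k using emb_nth[of a "- int k"] by simp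
  then show "a = 0" by (simp add: poly_eqI)
qed simp

lemma emb_eq_iff [simp]: "emb a = emb b \<longleftrightarrow> a = b"
  using emb_eq_0_iff[of "a - b"] by (simp add: emb_diff del: emb_eq_0_iff)

lemma fls_subdegree_emb: "fls_subdegree (emb a) = - int (degree a)"
proof (cases "a = 0")
  case False
  then show ?thesis
    by (intro fls_subdegree_eqI) (auto simp: emb_nth coeff_eq_0)
qed simp

lemma theta_power_eq_iff [simp]: "(theta :: 'a::field fls) ^ i = theta ^ j \<longleftrightarrow> i = j"
proof
  assume "theta ^ i = (theta :: 'a fls) ^ j"
  then have "fls_subdegree ((theta :: 'a fls) ^ i) = fls_subdegree ((theta :: 'a fls) ^ j)" by simp
  then show "i = j" unfolding theta_def fls_subdegree_fls_X_inv_pow by simp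
qed simp

abbreviation monics_of_degree :: "nat \<Rightarrow> 'a::field poly set" where
  "monics_of_degree d \<equiv> {a \<in> monics. degree a = d}"

lemma monics_of_degree_0: "monics_of_degree 0 = {1}"
proof -
  have "a = 1" if "lead_coeff a = 1" "degree a = 0" for a :: "'a poly"
    using degree_eq_zeroE[OF that(2)] that(1) by (metis coeff_pCons_0 one_pCons that(2))
  then show ?thesis by (auto simp: monics_def)
qed

text \<open>Splitting off the constant term, \<open>a = c + theta b\<close> with \<open>c\<close>
  free and \<open>b\<close> monic, drives the inductions on the degree.\<close>

lemma bij_betw_monics_of_degree_Suc:
  "bij_betw (\<lambda>(c::'a::field, b). pCons c b) (UNIV \<times> monics_of_degree d) (monics_of_degree (Suc d))"
proof (rule bij_betw_imageI)
  show "inj_on (\<lambda>(c::'a, b). pCons c b) (UNIV \<times> monics_of_degree d)"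
    by (simp add: inj_on_def)
  show "(\<lambda>(c::'a, b). pCons c b) ` (UNIV \<times> monics_of_degree d) = monics_of_degree (Suc d)"
  proof (intro equalityI subsetI)
    fix y :: "'a poly" assume y: "y \<in> monics_of_degree (Suc d)"
    obtain c b where cb: "y = pCons c b" by (rule pCons_cases)
    with y have "b \<in> monics_of_degree d" by (auto simp add: monics_def split: if_splits)
    with cb show "y \<in> (\<lambda>(c, b). pCons c b) ` (UNIV \<times> monics_of_degree d)"
      by (intro image_eqI[of _ _ "(c, b)"]) simp_all
  next
    fix y :: "'a poly" assume "y \<in> (\<lambda>(c, b). pCons c b) ` (UNIV \<times> monics_of_degree d)"
    then obtain c b where "y = pCons c b" "lead_coeff b = 1" "degree b = d"
      by (auto simp: monics_def)
    moreover from this have "b \<noteq> 0" by (metis coeff_0 zero_neq_one)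
    ultimately show "y \<in> monics_of_degree (Suc d)" by (simp add: monics_def)
  qed
qed

lemma finite_monics_of_degree: "finite (monics_of_degree d :: 'a::{field,finite} poly set)"
proof (induction d)
  case (Suc d)
  then show ?case
    using bij_betw_finite[OF bij_betw_monics_of_degree_Suc[where 'a='a, of d]] by simp
qed (simp add: monics_of_degree_0)

lemma card_monics_of_degree:
  "card (monics_of_degree d :: 'a::{field,finite} poly set) = CARD('a) ^ d"
proof (induction d)
  case (Suc d)
  then show ?case
    using bij_betw_same_card[OF bij_betw_monics_of_degree_Suc[where 'a='a, of d]]
    by (simp add: card_cartesian_product)
qed (simp add: monics_of_degree_0)

subsection \<open>Power sums of linear forms\<close>

text \<open>F_q-linearity, with F_q acting on Laurent series through the constants. The forms of
  interest are combinations of the maps \<open>a^(q^j)\<close>.\<close>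

definition poly_linear :: "('a::field poly \<Rightarrow> 'a fls) \<Rightarrow> bool" where
  "poly_linear g \<longleftrightarrow> (\<forall>a b. g (a + b) = g a + g b) \<and> (\<forall>c a. g (smult c a) = fls_const c * g a)"

lemma poly_linear_sum:
  assumes "\<And>i. i \<in> I \<Longrightarrow> poly_linear (g i)"
  shows "poly_linear (\<lambda>a. \<Sum>i\<in>I. e i * g i a)"
  using assms by (simp add: poly_linear_def sum_distrib_left sum.distrib algebra_simps cong: sum.cong)

lemma fls_const_sum: "fls_const (sum f A) = (\<Sum>x\<in>A. fls_const (f x))"
  by (induction A rule: infinite_finite_induct) (auto simp flip: fls_plus_const)

text \<open>Induction on \<open>d\<close>: with \<open>a = c + theta b\<close>, expand the product
  by the set \<open>J\<close> of factors that contribute their \<open>c\<close>-part. The sum of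
  \<open>c^(card J)\<close> over the field kills all \<open>J\<close> with fewer than
  \<open>q - 1\<close> elements.\<close>

lemma sum_prod_poly_linear_eq_0:
  fixes g :: "'i \<Rightarrow> 'a::{field,finite} poly \<Rightarrow> 'a fls"
  assumes "finite I" "\<And>i. i \<in> I \<Longrightarrow> poly_linear (g i)" "card I < d * (CARD('a) - 1)"
  shows "(\<Sum>a\<in>monics_of_degree d. \<Prod>i\<in>I. g i a) = 0"
  using assms
proof (induction d arbitrary: I g)
  case (Suc d)
  have lin: "g i (pCons c b) = fls_const c * g i 1 + g i (pCons 0 b)" if "i \<in> I" for i c b
  proof -
    have "pCons c b = smult c 1 + pCons 0 b" by (simp add: one_pCons)
    then show ?thesis using Suc.prems(2)[OF that] unfolding poly_linear_def by metis
  qed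
  have expand: "(\<Prod>i\<in>I. g i (pCons c b)) =
      (\<Sum>J\<in>Pow I. (\<Prod>i\<in>J. fls_const c * g i 1) * (\<Prod>i\<in>I-J. g i (pCons 0 b)))" for c b
  proof -
    have "(\<Prod>i\<in>I. g i (pCons c b)) = (\<Prod>i\<in>I. fls_const c * g i 1 + g i (pCons 0 b))"
      by (intro prod.cong refl lin)
    then show ?thesis by (simp only: prod_add[OF Suc.prems(1)])
  qed
  have "(\<Sum>a\<in>monics_of_degree (Suc d). \<Prod>i\<in>I. g i a)
      = (\<Sum>(c,b)\<in>UNIV \<times> monics_of_degree d. \<Prod>i\<in>I. g i (pCons c b))"
    by (subst sum.reindex_bij_betw[OF bij_betw_monics_of_degree_Suc, symmetric])
      (simp add: case_prod_unfold)
  also have "\<dots> = (\<Sum>c\<in>UNIV. \<Sum>b\<in>monics_of_degree d. \<Prod>i\<in>I. g i (pCons c b))"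
    by (rule sum.cartesian_product[symmetric])
  also have "\<dots> = (\<Sum>c\<in>UNIV. \<Sum>b\<in>monics_of_degree d. \<Sum>J\<in>Pow I.
      (\<Prod>i\<in>J. fls_const c * g i 1) * (\<Prod>i\<in>I-J. g i (pCons 0 b)))"
    by (intro sum.cong refl expand)
  also have "\<dots> = (\<Sum>c\<in>UNIV. \<Sum>J\<in>Pow I. \<Sum>b\<in>monics_of_degree d.
      (\<Prod>i\<in>J. fls_const c * g i 1) * (\<Prod>i\<in>I-J. g i (pCons 0 b)))"
    by (intro sum.cong refl sum.swap)
  also have "\<dots> = (\<Sum>J\<in>Pow I. \<Sum>c\<in>UNIV. \<Sum>b\<in>monics_of_degree d.
      (\<Prod>i\<in>J. fls_const c * g i 1) * (\<Prod>i\<in>I-J. g i (pCons 0 b)))"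
    by (rule sum.swap)
  also have "\<dots> = (\<Sum>J\<in>Pow I. (\<Sum>c\<in>UNIV. fls_const c ^ card J) *
      (\<Sum>b\<in>monics_of_degree d. (\<Prod>i\<in>J. g i 1) * (\<Prod>i\<in>I-J. g i (pCons 0 b))))"
    by (simp add: prod.distrib sum_product mult.assoc)
  also have "\<dots> = (\<Sum>J\<in>Pow I. fls_const (\<Sum>c\<in>UNIV. c ^ card J) * ((\<Prod>i\<in>J. g i 1) *
      (\<Sum>b\<in>monics_of_degree d. \<Prod>i\<in>I-J. g i (pCons 0 b))))"
    by (simp add: fls_const_sum fls_const_power flip: sum_distrib_left)
  also have "\<dots> = 0"
  proof (rule sum.neutral, rule ballI)
    fix J assume J: "J \<in> Pow I"
    show "fls_const (\<Sum>c\<in>UNIV. c ^ card J) * ((\<Prod>i\<in>J. g i 1) *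
      (\<Sum>b\<in>monics_of_degree d. \<Prod>i\<in>I-J. g i (pCons 0 b))) = 0"
    proof (cases "card J < CARD('a) - 1")
      case True
      then show ?thesis by (simp add: sum_power_eq_0)
    next
      case False
      \<comment> \<open>Here \<open>J\<close> has used up at least \<open>q - 1\<close> factors, so
        fewer than \<open>d (q - 1)\<close> forms in \<open>b\<close> remain and the induction
        hypothesis applies.\<close>
      have "(\<Sum>b\<in>monics_of_degree d. \<Prod>i\<in>I-J. g i (pCons 0 b)) = 0"
      proof (rule Suc.IH)
        show "card (I - J) < d * (CARD('a) - 1)"
        proof -
          have "card J \<le> card I" using J Suc.prems(1) by (auto intro: card_mono)
          moreover have "card (I - J) = card I - card J"
            using J Suc.prems(1) by (intro card_Diff_subset) (auto intro: finite_subset)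
          ultimately show ?thesis using False Suc.prems(3) by simp
        qed
        show "poly_linear (\<lambda>b. g i (pCons 0 b))" if "i \<in> I - J" for i
          using Suc.prems(2)[of i] that unfolding poly_linear_def
          by (metis DiffD1 add_pCons add_0 smult_pCons mult_zero_right)
      qed (use Suc.prems in auto)
      then show ?thesis by simp
    qed
  qed
  finally show ?case .
qed simp

subsection \<open>Interpolation\<close>

text \<open>For monic \<open>p\<close> of degree \<open>d\<close>, subtracting the product of the
  \<open>X - v j\<close> leaves degree below \<open>d\<close>, which is determined by the values at
  the nodes. What matters is that \<open>e\<close> is chosen before \<open>p\<close>.\<close>

lemma monic_interpolation:
  fixes u :: "'b::field" and v :: "nat \<Rightarrow> 'b"
  assumes "inj_on v {..<d}"
  shows "\<exists>e. \<forall>p. lead_coeff p = 1 \<and> degree p = d \<longrightarrow>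
    poly p u = (\<Prod>j<d. u - v j) + (\<Sum>j<d. e j * poly p (v j))"
  using assms
proof (induction d)
  case 0
  have "poly p u = 1" if "lead_coeff p = 1" "degree p = 0" for p
    using degree_eq_zeroE[OF that(2)] that(1) by (metis coeff_pCons_0 poly_pCons poly_0 mult_zero_right add_0_right that(2))
  then show ?case by auto
next
  case (Suc d)
  then obtain e where e: "\<And>p. lead_coeff p = 1 \<Longrightarrow> degree p = d \<Longrightarrow>
    poly p u = (\<Prod>j<d. u - v j) + (\<Sum>j<d. e j * poly p (v j))"
    by (auto simp: lessThan_Suc)
  \<comment> \<open>Dividing \<open>p\<close> by \<open>X - v d\<close> gives a monic quotient with
    value \<open>(poly p (v j) - poly p (v d)) / (v j - v d)\<close> at \<open>v j\<close>;
    substituting this into the hypothesis yields \<open>f\<close>, and the coefficient of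
    \<open>poly p (v d)\<close> becomes \<open>1 - (\<Sum>j<d. f j)\<close>.\<close>
  define f where "f j = (u - v d) * e j / (v j - v d)" for j
  define e' where "e' = (\<lambda>j. if j < d then f j else 1 - (\<Sum>j<d. f j))"
  have "poly p u = (\<Prod>j<Suc d. u - v j) + (\<Sum>j<Suc d. e' j * poly p (v j))"
    if p: "lead_coeff p = 1" "degree p = Suc d" for p
  proof -
    define s where "s = synthetic_div p (v d)"
    have ps: "p = [:- v d, 1:] * s + [:poly p (v d):]"
      unfolding s_def by (rule synthetic_div_correct'[symmetric])
    have deg: "degree s = d" unfolding s_def by (simp add: degree_synthetic_div p)
    have "lead_coeff p = coeff ([:- v d, 1:] * s + [:poly p (v d):]) (Suc d)"
      using p(2) ps by simp
    also have "\<dots> = coeff s d" using deg by (simp add: coeff_eq_0)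
    finally have "lead_coeff s = 1" using p(1) deg by simp
    note IH = e[OF this deg]
    have ev: "poly p x = (x - v d) * poly s x + poly p (v d)" for x
      using arg_cong[OF ps, of "\<lambda>p. poly p x"] by (simp add: algebra_simps)
    have f: "f j * poly p (v j) = (u - v d) * e j * poly s (v j) + f j * poly p (v d)" if "j < d" for j
    proof -
      have "v j - v d \<noteq> 0" using Suc.prems that by (auto simp: inj_on_def)
      then show ?thesis by (subst ev[of "v j"]) (simp add: f_def distrib_left)
    qed
    have "poly p u = (u - v d) * (\<Prod>j<d. u - v j) + (\<Sum>j<d. (u - v d) * e j * poly s (v j)) + poly p (v d)"
      using ev[of u] by (simp add: IH algebra_simps sum_distrib_left)
    also have "\<dots> = (\<Prod>j<Suc d. u - v j) + (\<Sum>j<d. f j * poly p (v j)) + (1 - (\<Sum>j<d. f j)) * poly p (v d)"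
      by (simp add: f sum.distrib sum_distrib_right left_diff_distrib) (simp add: algebra_simps)
    also have "\<dots> = (\<Prod>j<Suc d. u - v j) + (\<Sum>j<Suc d. e' j * poly p (v j))"
      by (simp add: e'_def)
    finally show ?thesis .
  qed
  then show ?case by blast
qed

section \<open>Frobenius powers on Laurent series\<close>

lemma fls_frobenius_add:
  fixes x y :: "'a::{field,finite} fls"
  shows "(x + y) ^ (CHAR('a) ^ m) = x ^ (CHAR('a) ^ m) + y ^ (CHAR('a) ^ m)"
  by (rule freshmans_dream') (simp_all add: finite_field_prime_CHAR)

lemma fls_frobenius_sum:
  fixes f :: "'b \<Rightarrow> 'a::{field,finite} fls"
  shows "sum f A ^ (CHAR('a) ^ m) = (\<Sum>x\<in>A. f x ^ (CHAR('a) ^ m))"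
  by (rule freshmans_dream_sum') (simp_all add: finite_field_prime_CHAR)

lemma fls_frobenius_diff:
  fixes x y :: "'a::{field,finite} fls"
  shows "(x - y) ^ (CHAR('a) ^ m) = x ^ (CHAR('a) ^ m) - y ^ (CHAR('a) ^ m)"
  using fls_frobenius_add[of "x - y" y m] by (simp add: algebra_simps)

lemma power_CARD_power_eq: "(x::'a::{field,finite}) ^ (CARD('a) ^ j) = x"
  by (induction j) (simp_all add: power_CARD_eq power_mult)

subsection \<open>Values of S in terms of ell\<close>

text \<open>The signed version of \<open>L\<close> for which \<open>S d 1\<close> is exactly
  \<open>1 / ell d\<close>; signs stay out of the computation until the final conversion.\<close>

definition ell :: "nat \<Rightarrow> 'a::{field,finite} fls" where
  "ell d = (\<Prod>j=1..d. theta - theta ^ (CARD('a) ^ j))"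

text \<open>The value at \<open>theta\<close> of the monic polynomial with roots
  \<open>theta^(q^(n + j))\<close>, \<open>j < d\<close>: the constant term of the
  interpolation.\<close>

definition theta_prod :: "nat \<Rightarrow> nat \<Rightarrow> 'a::{field,finite} fls" where
  "theta_prod n d = (\<Prod>j<d. theta - theta ^ (CARD('a) ^ (n + j)))"

lemma theta_diff_nonzero: "j \<ge> 1 \<Longrightarrow> theta - theta ^ (CARD('a) ^ j) \<noteq> (0::'a::{field,finite} fls)"
  using theta_power_eq_iff[of 1 "CARD('a) ^ j", where 'a='a] CARD_gt_1[where 'a='a]
    one_less_power[of "CARD('a)" j] by auto

lemma ell_0 [simp]: "ell 0 = 1"
  by (simp add: ell_def)

lemma ell_Suc: "ell (Suc d) = ell d * (theta - theta ^ (CARD('a) ^ Suc d) :: 'a::{field,finite} fls)"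
  by (simp add: ell_def)

lemma ell_nonzero [simp]: "ell d \<noteq> (0 :: 'a::{field,finite} fls)"
  by (induction d) (use theta_diff_nonzero[where 'a='a] in \<open>auto simp: ell_Suc simp del: power_Suc\<close>)

lemma ell_conv_L: "ell d = (- 1) ^ d * L d"
  by (induction d) (simp_all add: ell_Suc L_def bracket_def algebra_simps)

lemma theta_prod_eq_ell: "theta_prod (Suc n) d = ell (n + d) / ell n"
  by (induction d) (simp_all add: theta_prod_def ell_Suc)

text \<open>Writing \<open>q\<close> as a power of the characteristic makes \<open>x^(q^j)\<close> a
  Frobenius power, hence additive, and lets exponents \<open>p^m q^e\<close> be treated as one
  Frobenius power.\<close>

locale finite_constants =
  fixes l :: nat and ty :: "'a::{field,finite} itself"
  assumes CARD_eq: "CARD('a) = CHAR('a) ^ l"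
begin

lemma q_power_eq: "CARD('a) ^ j = CHAR('a) ^ (l * j)"
  by (simp add: CARD_eq power_mult)

lemmas q_frobenius_add = fls_frobenius_add[where 'a='a and m="l * j" for j, folded q_power_eq]
lemmas q_frobenius_sum = fls_frobenius_sum[where 'a='a and m="l * j" for j, folded q_power_eq]
lemmas q_frobenius_diff = fls_frobenius_diff[where 'a='a and m="l * j" for j, folded q_power_eq]

text \<open>Frobenius fixes the coefficients and moves only \<open>theta\<close>. Thus values of
  \<open>a\<close> at the interpolation nodes are powers of \<open>a\<close>.\<close>

lemma emb_power_q_power:
  "emb (a::'a poly) ^ (CARD('a) ^ j) = poly (map_poly fls_const a) (theta ^ (CARD('a) ^ j))"
proof (induction a)
  case (pCons c a)
  then show ?case
    by (simp add: q_frobenius_add power_mult_distrib map_poly_pCons power_CARD_power_eq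
        flip: fls_const_power)
qed (simp add: power_0_left)

lemma poly_linear_power_q: "poly_linear (\<lambda>a::'a poly. emb a ^ (CARD('a) ^ j))"
  by (simp add: poly_linear_def emb_add emb_smult q_frobenius_add power_mult_distrib
      power_CARD_power_eq flip: fls_const_power)

lemma emb_interpolation:
  "\<exists>e. \<forall>a\<in>monics_of_degree d.
    emb (a::'a poly) = theta_prod n d + (\<Sum>j<d. e j * emb a ^ (CARD('a) ^ (n + j)))"
proof -
  define v where "v j = (theta :: 'a fls) ^ (CARD('a) ^ (n + j))" for j
  have "inj_on v {..<d}"
    using CARD_gt_1[where 'a='a] by (auto simp: inj_on_def v_def power_inject_exp)
  from monic_interpolation[OF this, of theta] obtain e where
    e: "\<And>p. lead_coeff p = 1 \<Longrightarrow> degree p = d \<Longrightarrow>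
      poly p theta = (\<Prod>j<d. theta - v j) + (\<Sum>j<d. e j * poly p (v j))" by auto
  have "emb a = theta_prod n d + (\<Sum>j<d. e j * emb a ^ (CARD('a) ^ (n + j)))"
    if a: "a \<in> monics_of_degree d" for a :: "'a poly"
  proof -
    have "degree (map_poly fls_const a) = d"
      using a by (subst map_poly_degree_eq) (auto simp: monics_def)
    moreover from this have "lead_coeff (map_poly fls_const a) = 1"
      using a by (auto simp: coeff_map_poly monics_def)
    ultimately show ?thesis
      using e[of "map_poly fls_const a"] by (simp add: emb_power_q_power v_def theta_prod_def) (simp add: emb_def)
  qed
  then show ?thesis by blast
qed

text \<open>Interpolate with \<open>n - i\<close> in place of \<open>n\<close> and raise to the
  power \<open>q^i\<close>. All \<open>i\<close> then share the same powers
  \<open>a^(q^(n + j))\<close>, each divisible by \<open>a^(q^n)\<close>.\<close>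

lemma emb_power_interpolation:
  assumes "i \<le> n"
  shows "\<exists>e. \<forall>a\<in>monics_of_degree d.
    emb (a::'a poly) ^ (CARD('a) ^ i) = theta_prod (n - i) d ^ (CARD('a) ^ i) + (\<Sum>j<d. e j * emb a ^ (CARD('a) ^ (n + j)))"
proof -
  obtain e where e: "\<And>a::'a poly. a \<in> monics_of_degree d \<Longrightarrow>
    emb a = theta_prod (n - i) d + (\<Sum>j<d. e j * emb a ^ (CARD('a) ^ (n - i + j)))"
    using emb_interpolation[of d "n - i"] by blast
  have "emb a ^ (CARD('a) ^ i) = theta_prod (n - i) d ^ (CARD('a) ^ i) + (\<Sum>j<d. e j ^ (CARD('a) ^ i) * emb a ^ (CARD('a) ^ (n + j)))"
    if "a \<in> monics_of_degree d" for a :: "'a poly"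
  proof -
    have "CARD('a) ^ (n - i + j) * CARD('a) ^ i = CARD('a) ^ (n + j)" for j
      using assms by (simp flip: power_add)
    then have "(\<Sum>j<d. e j * emb a ^ (CARD('a) ^ (n - i + j))) ^ (CARD('a) ^ i)
        = (\<Sum>j<d. e j ^ (CARD('a) ^ i) * emb a ^ (CARD('a) ^ (n + j)))"
      by (simp add: q_frobenius_sum power_mult_distrib flip: power_mult)
    then show ?thesis
      by (subst e[OF that]) (simp only: q_frobenius_add)
  qed
  then show ?thesis by (intro exI[of _ "\<lambda>j. e j ^ (CARD('a) ^ i)"]) blast
qed

text \<open>One factor of the product absorbs the negative power. Each resulting term is a product
  of \<open>j (q - 1) + card J - 1\<close> linear forms, which is less than \<open>d (q - 1)\<close>
  because \<open>j < d\<close> and \<open>card J \<le> q - 1\<close>.\<close>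

lemma sum_inverse_emb_prod_eq_0:
  fixes e :: "'i \<Rightarrow> nat \<Rightarrow> 'a fls"
  assumes "finite J" "J \<noteq> {}" "card J \<le> CARD('a) - 1"
  shows "(\<Sum>a\<in>monics_of_degree d. inverse (emb a ^ (CARD('a) ^ n)) *
    (\<Prod>i\<in>J. \<Sum>j<d. e i j * emb a ^ (CARD('a) ^ (n + j)))) = 0"
proof -
  define h where "h i a = (\<Sum>j<d. e i j * emb a ^ (CARD('a) ^ (n + j)))" for i and a :: "'a poly"
  \<comment> \<open>Only the factor \<open>i0\<close> is expanded, to cancel \<open>a^(q^n)\<close>;
    the others are kept whole as linear forms.\<close>
  obtain i0 where i0: "i0 \<in> J" using assms by blast
  have lin: "poly_linear (h i)" for i
    unfolding h_def by (intro poly_linear_sum poly_linear_power_q)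
  have vanish: "(\<Sum>a\<in>monics_of_degree d. inverse (emb a ^ (CARD('a) ^ n)) * emb a ^ (CARD('a) ^ (n + j))
      * (\<Prod>i\<in>J - {i0}. h i a)) = 0" if j: "j < d" for j
  proof -
    \<comment> \<open>\<open>a^(q^(n + j) - q^n)\<close> is a product of \<open>j (q - 1)\<close> linear forms.\<close>
    define I' where "I' = ({..<j} \<times> {..<CARD('a) - 1}) <+> (J - {i0})"
    define g where "g = case_sum (\<lambda>(t, _::nat). \<lambda>a::'a poly. emb a ^ (CARD('a) ^ (n + t))) h"
    have "(\<Sum>a\<in>monics_of_degree d. \<Prod>i\<in>I'. g i a) = 0"
    proof (rule sum_prod_poly_linear_eq_0)
      show "finite I'" using assms by (simp add: I'_def)
      show "poly_linear (g i)" for i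
        by (cases i) (auto simp: g_def lin poly_linear_power_q)
      have "card I' = j * (CARD('a) - 1) + (card J - 1)"
        using assms i0 by (simp add: I'_def card_Plus)
      also have "\<dots> < j * (CARD('a) - 1) + (CARD('a) - 1)"
        using assms i0 CARD_gt_1[where 'a='a] by (intro add_strict_left_mono) linarith
      also have "\<dots> = Suc j * (CARD('a) - 1)" by simp
      also have "\<dots> \<le> d * (CARD('a) - 1)" using j by (intro mult_right_mono) auto
      finally show "card I' < d * (CARD('a) - 1)" .
    qed
    moreover have "(\<Prod>i\<in>I'. g i a) = inverse (emb a ^ (CARD('a) ^ n)) * emb a ^ (CARD('a) ^ (n + j)) * (\<Prod>i\<in>J - {i0}. h i a)"
      if "a \<in> monics_of_degree d" for a
    proof -
      have nz: "emb a \<noteq> 0" using that by (auto simp: monics_def)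
      have "(\<Prod>t<k. (emb a ^ (CARD('a) ^ (n + t))) ^ (CARD('a) - 1)) * emb a ^ (CARD('a) ^ n) = emb a ^ (CARD('a) ^ (n + k))" for k
      proof (induction k)
        case (Suc k)
        have "CARD('a) ^ (n + k) * (CARD('a) - 1) + CARD('a) ^ (n + k) = CARD('a) ^ (n + k) * CARD('a)"
          using CARD_gt_1[where 'a='a] by (simp add: diff_mult_distrib2)
        then have step: "(emb a ^ (CARD('a) ^ (n + k))) ^ (CARD('a) - 1) * emb a ^ (CARD('a) ^ (n + k)) = emb a ^ (CARD('a) ^ (n + Suc k))"
          by (metis add_Suc_right power_Suc2 power_add power_mult)
        have "(\<Prod>t<Suc k. (emb a ^ (CARD('a) ^ (n + t))) ^ (CARD('a) - 1)) * emb a ^ (CARD('a) ^ n)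
            = (emb a ^ (CARD('a) ^ (n + k))) ^ (CARD('a) - 1) *
              ((\<Prod>t<k. (emb a ^ (CARD('a) ^ (n + t))) ^ (CARD('a) - 1)) * emb a ^ (CARD('a) ^ n))"
          by (simp only: prod.lessThan_Suc mult_ac)
        then show ?case by (simp only: Suc.IH step)
      qed simp
      from this[of j] have "(\<Prod>t<j. (emb a ^ (CARD('a) ^ (n + t))) ^ (CARD('a) - 1)) = inverse (emb a ^ (CARD('a) ^ n)) * emb a ^ (CARD('a) ^ (n + j))"
        using nz by (simp add: field_simps)
      moreover have "(\<Prod>i\<in>I'. g i a) = (\<Prod>t<j. (emb a ^ (CARD('a) ^ (n + t))) ^ (CARD('a) - 1)) * (\<Prod>i\<in>J - {i0}. h i a)"
        using assms unfolding I'_def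
        by (subst prod.Plus)
          (simp_all add: g_def case_prod_unfold prod.cartesian_product[symmetric, where g="\<lambda>t _. emb a ^ (CARD('a) ^ (n + t))", simplified case_prod_unfold])
      ultimately show ?thesis by simp
    qed
    ultimately show ?thesis by simp
  qed
  have "(\<Sum>a\<in>monics_of_degree d. inverse (emb a ^ (CARD('a) ^ n)) * (\<Prod>i\<in>J. h i a))
      = (\<Sum>a\<in>monics_of_degree d. \<Sum>j<d. e i0 j * (inverse (emb a ^ (CARD('a) ^ n)) * emb a ^ (CARD('a) ^ (n + j))
      * (\<Prod>i\<in>J - {i0}. h i a)))"
    by (intro sum.cong refl, subst prod.remove[OF assms(1) i0], subst (1) h_def)
      (simp add: sum_distrib_left sum_distrib_right mult_ac)
  also have "\<dots> = (\<Sum>j<d. e i0 j * (\<Sum>a\<in>monics_of_degree d. inverse (emb a ^ (CARD('a) ^ n)) * emb a ^ (CARD('a) ^ (n + j))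
      * (\<Prod>i\<in>J - {i0}. h i a)))"
    by (subst sum.swap) (simp add: sum_distrib_left)
  also have "\<dots> = 0" using vanish by simp
  finally show ?thesis by (simp add: h_def)
qed

text \<open>Expand each power as its interpolation constant plus a linear form. Every term
  containing at least one linear form sums to zero, so only the empty subset survives.\<close>

lemma sum_inverse_emb_prod:
  assumes "finite I" "card I \<le> CARD('a) - 1" "\<And>i. i \<in> I \<Longrightarrow> k i \<le> n"
  shows "(\<Sum>a\<in>monics_of_degree d. inverse (emb (a::'a poly) ^ (CARD('a) ^ n)) * (\<Prod>i\<in>I. emb a ^ (CARD('a) ^ k i)))
    = (\<Prod>i\<in>I. theta_prod (n - k i) d ^ (CARD('a) ^ k i)) * (\<Sum>a\<in>monics_of_degree d. inverse (emb (a::'a poly) ^ (CARD('a) ^ n)))"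
proof -
  have "\<exists>e. \<forall>i\<in>I. \<forall>a\<in>monics_of_degree d. emb (a::'a poly) ^ (CARD('a) ^ k i) =
      theta_prod (n - k i) d ^ (CARD('a) ^ k i) + (\<Sum>j<d. e i j * emb a ^ (CARD('a) ^ (n + j)))"
    using emb_power_interpolation assms(3) by (intro bchoice) blast
  then obtain e where e: "\<And>i a. i \<in> I \<Longrightarrow> a \<in> monics_of_degree d \<Longrightarrow> emb (a::'a poly) ^ (CARD('a) ^ k i) =
      theta_prod (n - k i) d ^ (CARD('a) ^ k i) + (\<Sum>j<d. e i j * emb a ^ (CARD('a) ^ (n + j)))" by blast
  define A where "A i = (theta_prod (n - k i) d :: 'a fls) ^ (CARD('a) ^ k i)" for i
  define h where "h i a = (\<Sum>j<d. e i j * emb a ^ (CARD('a) ^ (n + j)))" for i and a :: "'a poly"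
  have expand: "(\<Prod>i\<in>I. emb a ^ (CARD('a) ^ k i)) = (\<Sum>J\<in>Pow I. (\<Prod>i\<in>J. h i a) * (\<Prod>i\<in>I-J. A i))"
    if "a \<in> monics_of_degree d" for a :: "'a poly"
  proof -
    have "(\<Prod>i\<in>I. emb a ^ (CARD('a) ^ k i)) = (\<Prod>i\<in>I. h i a + A i)"
      using e that by (intro prod.cong refl) (simp add: A_def h_def add.commute)
    then show ?thesis by (simp only: prod_add[OF assms(1)])
  qed
  have "(\<Sum>a\<in>monics_of_degree d. inverse (emb (a::'a poly) ^ (CARD('a) ^ n)) * (\<Prod>i\<in>I. emb a ^ (CARD('a) ^ k i)))
      = (\<Sum>a\<in>monics_of_degree d. \<Sum>J\<in>Pow I. (\<Prod>i\<in>I-J. A i) * (inverse (emb (a::'a poly) ^ (CARD('a) ^ n)) * (\<Prod>i\<in>J. h i a)))"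
    by (intro sum.cong refl) (simp add: expand sum_distrib_left mult_ac)
  also have "\<dots> = (\<Sum>J\<in>Pow I. (\<Prod>i\<in>I-J. A i) *
      (\<Sum>a\<in>monics_of_degree d. inverse (emb (a::'a poly) ^ (CARD('a) ^ n)) * (\<Prod>i\<in>J. h i a)))"
    by (subst sum.swap) (simp add: sum_distrib_left)
  also have "\<dots> = (\<Sum>J\<in>{{}}. (\<Prod>i\<in>I-J. A i) *
      (\<Sum>a\<in>monics_of_degree d. inverse (emb (a::'a poly) ^ (CARD('a) ^ n)) * (\<Prod>i\<in>J. h i a)))"
  proof (rule sum.mono_neutral_right)
    show "\<forall>J\<in>Pow I - {{}}. (\<Prod>i\<in>I-J. A i) *
      (\<Sum>a\<in>monics_of_degree d. inverse (emb (a::'a poly) ^ (CARD('a) ^ n)) * (\<Prod>i\<in>J. h i a)) = 0"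
    proof
      fix J assume J: "J \<in> Pow I - {{}}"
      have "card J \<le> CARD('a) - 1" using J assms(1,2) card_mono[of I J] by auto
      then have "(\<Sum>a\<in>monics_of_degree d. inverse (emb a ^ (CARD('a) ^ n)) * (\<Prod>i\<in>J. h i a)) = 0"
        unfolding h_def using J assms(1) by (intro sum_inverse_emb_prod_eq_0) (auto intro: finite_subset)
      then show "(\<Prod>i\<in>I-J. A i) *
        (\<Sum>a\<in>monics_of_degree d. inverse (emb (a::'a poly) ^ (CARD('a) ^ n)) * (\<Prod>i\<in>J. h i a)) = 0" by simp
    qed
  qed (use assms in auto)
  finally show ?thesis by (simp add: A_def)
qed

lemma S_q_power_minus:
  assumes "(\<Sum>i<n. N i) \<le> CARD('a) - 1"
  shows "S d (int (CARD('a) ^ n) - (\<Sum>i<n. int (N i * CARD('a) ^ i)))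
    = (\<Prod>i<n. (theta_prod (n - i) d ^ (CARD('a) ^ i)) ^ N i) * (S d (int (CARD('a) ^ n)) :: 'a fls)"
proof -
  \<comment> \<open>Each position \<open>i\<close> occurs \<open>N i\<close> times, so
    \<open>card I\<close> is the digit sum and the product over \<open>I\<close> has one q-power per
    factor.\<close>
  define I where "I = Sigma {..<n} (\<lambda>i. {..<N i})"
  have pr: "(\<Prod>x\<in>I. f (fst x)) = (\<Prod>i<n. f i ^ N i)" for f :: "nat \<Rightarrow> 'a fls"
    unfolding I_def by (subst prod.Sigma[symmetric, where g="\<lambda>i _. f i", unfolded case_prod_unfold]) auto
  have "S d (int (CARD('a) ^ n) - (\<Sum>i<n. int (N i * CARD('a) ^ i)))
      = (\<Sum>a\<in>monics_of_degree d. inverse (emb (a::'a poly) ^ (CARD('a) ^ n)) * (\<Prod>x\<in>I. emb a ^ (CARD('a) ^ fst x)))"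
    unfolding S_def
  proof (rule sum.cong)
    fix a :: "'a poly" assume "a \<in> monics_of_degree d"
    then have nz: "emb a \<noteq> 0" by (auto simp: monics_def)
    have "- (int (CARD('a) ^ n) - (\<Sum>i<n. int (N i * CARD('a) ^ i))) = int (\<Sum>i<n. CARD('a) ^ i * N i) - int (CARD('a) ^ n)"
      by (simp add: mult.commute)
    then have "emb a powi (- (int (CARD('a) ^ n) - (\<Sum>i<n. int (N i * CARD('a) ^ i))))
        = emb a ^ (\<Sum>i<n. CARD('a) ^ i * N i) / emb a ^ (CARD('a) ^ n)"
      using nz by (simp only: power_int_diff power_int_of_nat simp_thms)
    also have "\<dots> = inverse (emb a ^ (CARD('a) ^ n)) * (\<Prod>x\<in>I. emb a ^ (CARD('a) ^ fst x))"
      by (simp add: pr[of "\<lambda>i. emb a ^ (CARD('a) ^ i)"] power_sum power_mult divide_inverse mult.commute[of _ "inverse _"])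
    finally show "emb a powi (- (int (CARD('a) ^ n) - (\<Sum>i<n. int (N i * CARD('a) ^ i))))
        = inverse (emb a ^ (CARD('a) ^ n)) * (\<Prod>x\<in>I. emb a ^ (CARD('a) ^ fst x))" .
  qed simp
  also have "\<dots> = (\<Prod>x\<in>I. theta_prod (n - fst x) d ^ (CARD('a) ^ fst x)) *
      (\<Sum>a\<in>monics_of_degree d. inverse (emb (a::'a poly) ^ (CARD('a) ^ n)))"
    by (rule sum_inverse_emb_prod) (use assms in \<open>auto simp: I_def\<close>)
  also have "(\<Sum>a\<in>monics_of_degree d. inverse (emb (a::'a poly) ^ (CARD('a) ^ n))) = S d (int (CARD('a) ^ n))"
    unfolding S_def by (simp only: power_int_minus power_int_of_nat)
  also have "(\<Prod>x\<in>I. theta_prod (n - fst x) d ^ (CARD('a) ^ fst x)) = (\<Prod>i<n. ((theta_prod (n - i) d :: 'a fls) ^ (CARD('a) ^ i)) ^ N i)"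
    by (rule pr)
  finally show ?thesis .
qed

section \<open>Power sums at 1, at powers of \<open>q\<close>, and in closed form\<close>

lemma S_frobenius: "(S d s :: 'a fls) ^ (CHAR('a) ^ m) = S d (int (CHAR('a) ^ m) * s)"
  unfolding S_def fls_frobenius_sum
  by (intro sum.cong refl) (simp add: power_int_power' mult.commute)

text \<open>
  The monic polynomials of degree \<open>d\<close> are exactly the roots of a polynomial \<open>Q\<close> with
  \<open>Q(0) = - ell d\<close> and \<open>Q'(0) = 1\<close>, so the logarithmic derivative at \<open>0\<close> gives the sum of
  their inverses.
\<close>
lemma S_1: "S d 1 = inverse (ell d :: 'a fls)"
proof -
  obtain e where e: "\<And>a::'a poly. a \<in> monics_of_degree d \<Longrightarrow>
    emb a = theta_prod 1 d + (\<Sum>j<d. e j * emb a ^ (CARD('a) ^ (1 + j)))"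
    using emb_interpolation[of d 1] by blast
  define X where "X = emb ` (monics_of_degree d :: 'a poly set)"
  have inj: "inj_on emb (monics_of_degree d :: 'a poly set)" by (simp add: inj_on_def)
  have X: "finite X" "card X = CARD('a) ^ d" "0 \<notin> X"
    using inj by (auto simp: X_def finite_monics_of_degree card_image card_monics_of_degree) (auto simp: monics_def)
  \<comment> \<open>The interpolation relation for \<open>n = 1\<close>, whose constant
    \<open>theta_prod 1 d\<close> is \<open>ell d\<close>, read as a polynomial equation satisfied
    by every \<open>emb a\<close>.\<close>
  define Q where "Q = [:- ell d, 1:] - (\<Sum>j<d. monom (e j) (CARD('a) ^ (1 + j)))"
  define R where "R = (\<Prod>x\<in>X. [:- x, 1:])"
  define c where "c = coeff Q (CARD('a) ^ d)"
  have "degree (\<Sum>j<d. monom (e j) (CARD('a) ^ (1 + j))) \<le> CARD('a) ^ d"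
  proof (intro degree_sum_le)
    fix j assume "j \<in> {..<d}"
    then have "CARD('a) ^ (1 + j) \<le> CARD('a) ^ d"
      using CARD_gt_1[where 'a='a] by (intro power_increasing) auto
    then show "degree (monom (e j) (CARD('a) ^ (1 + j))) \<le> CARD('a) ^ d"
      using degree_monom_le order_trans by blast
  qed simp
  then have degQ: "degree Q \<le> CARD('a) ^ d"
    unfolding Q_def by (intro degree_diff_le) (auto intro: order_trans)
  have degR: "degree R = CARD('a) ^ d"
    unfolding R_def using X by (subst degree_prod_eq_sum_degree) auto
  have "lead_coeff R = 1" unfolding R_def lead_coeff_prod by simp
  \<comment> \<open>Both sides have degree at most \<open>q^d\<close>, agree at the
    \<open>q^d\<close> points of \<open>X\<close>, and share the coefficient of that degree. The
    value of \<open>c\<close> cancels later.\<close>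
  then have "Q = smult c R"
  proof (intro poly_eqI_degree_lead_coeff[where A=X and n="CARD('a) ^ d"])
    show "poly Q z = poly (smult c R) z" if "z \<in> X" for z
    proof -
      from that obtain a where a: "a \<in> monics_of_degree d" "z = emb a" by (auto simp: X_def)
      have "poly Q z = 0"
        using e[OF a(1)] by (simp add: Q_def a(2) poly_sum poly_monom theta_prod_eq_ell[of 0, simplified] diff_eq_eq add.commute)
      moreover have "poly R z = 0" using that X(1) by (auto simp: R_def poly_prod)
      ultimately show ?thesis by simp
    qed
  qed (use X degQ degR in \<open>auto simp: c_def intro: order_trans[OF degree_smult_le]\<close>)
  \<comment> \<open>All other nonconstant terms of \<open>Q\<close> have exponents at least
    \<open>q > 1\<close>.\<close>
  have "coeff Q 1 = 1"
    using CARD_gt_1[where 'a='a] by (simp add: Q_def coeff_sum)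
  moreover have "coeff Q 1 = poly (pderiv Q) 0" by (simp add: poly_0_coeff_0 coeff_pderiv)
  ultimately have "1 = c * poly (pderiv R) 0" using \<open>Q = smult c R\<close> by (simp add: pderiv_smult)
  \<comment> \<open>Since 0 is not in \<open>X\<close>, the product with one factor omitted is
    \<open>R(0)\<close> divided by that factor \<open>- x\<close>.\<close>
  also have "poly (pderiv R) 0 = (\<Sum>x\<in>X. poly R 0 * - inverse x)"
  proof -
    have "poly R 0 * - inverse x = (\<Prod>y\<in>X - {x}. - y)" if "x \<in> X" for x
    proof -
      have "poly R 0 = - x * (\<Prod>y\<in>X - {x}. - y)"
        unfolding R_def poly_prod using X(1) that by (simp add: prod.remove)
      moreover have "x \<noteq> 0" using that X(3) by auto
      ultimately show ?thesis by simp
    qed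
    then show ?thesis by (simp add: R_def pderiv_prod poly_sum poly_prod pderiv_pCons)
  qed
  also have "c * (\<Sum>x\<in>X. poly R 0 * - inverse x) = - poly Q 0 * (\<Sum>x\<in>X. inverse x)"
    using \<open>Q = smult c R\<close> by (simp add: sum_negf sum_distrib_left mult.assoc)
  also have "poly Q 0 = - ell d"
    by (simp add: Q_def poly_sum poly_monom power_0_left)
  also have "(\<Sum>x\<in>X. inverse x) = S d 1"
    unfolding X_def S_def by (subst sum.reindex[OF inj]) (simp add: power_int_minus)
  finally show ?thesis by (simp add: field_simps)
qed

lemma S_q_power: "S d (int (CARD('a) ^ n)) = inverse (ell d :: 'a fls) ^ (CARD('a) ^ n)"
  using S_frobenius[of d 1 "l * n"] by (simp add: S_1 flip: q_power_eq)

text \<open>The evaluation on which the rest depends: it is applied to \<open>q - 1\<close>, to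
  \<open>s1\<close>, and, with a longer digit list, to \<open>w\<close>.\<close>

lemma S_eq_ell:
  assumes "(\<Sum>i<n. N i) \<le> CARD('a) - 1"
  shows "S d (int (CARD('a) ^ n) - (\<Sum>i<n. int (N i * CARD('a) ^ i)))
    = (\<Prod>i<n. (ell (n - 1 - i + d) / ell (n - 1 - i)) ^ (N i * CARD('a) ^ i)) / (ell d :: 'a fls) ^ (CARD('a) ^ n)"
proof -
  have "theta_prod (n - i) d = (ell (n - 1 - i + d) / ell (n - 1 - i) :: 'a fls)" if "i < n" for i
    using theta_prod_eq_ell[of "n - 1 - i" d, where 'a='a] that by (simp add: Suc_diff_Suc)
  then have "(\<Prod>i<n. ((theta_prod (n - i) d :: 'a fls) ^ (CARD('a) ^ i)) ^ N i)
    = (\<Prod>i<n. (ell (n - 1 - i + d) / ell (n - 1 - i)) ^ (N i * CARD('a) ^ i))"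
    by (intro prod.cong refl) (simp add: mult.commute flip: power_mult)
  then show ?thesis
    by (simp only: S_q_power_minus[OF assms] S_q_power divide_inverse power_inverse)
qed

end

subsection \<open>Partial sums of multizeta values\<close>

text \<open>The multizeta sum truncated to tuples with largest degree below \<open>d\<close>,
  arranged so that the inner sums can be evaluated first.\<close>

primrec S_less :: "int list \<Rightarrow> nat \<Rightarrow> 'a::{field,finite} fls" where
  "S_less [] d = 1"
| "S_less (s # ss) d = (\<Sum>j<d. S j s * S_less ss j)"

definition decreasing_lists :: "nat \<Rightarrow> nat \<Rightarrow> nat list set" where
  "decreasing_lists k d = {ds. length ds = k \<and> sorted_wrt (>) ds \<and> (\<forall>x\<in>set ds. x < d)}"

lemma decreasing_lists_0: "decreasing_lists 0 d = {[]}"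
  by (auto simp: decreasing_lists_def)

lemma bij_betw_decreasing_lists_Suc:
  "bij_betw (\<lambda>(j, ds). j # ds) (SIGMA j:{..<d}. decreasing_lists k j) (decreasing_lists (Suc k) d)"
  unfolding bij_betw_def
proof (intro conjI equalityI subsetI)
  show "inj_on (\<lambda>(j, ds). j # ds) (SIGMA j:{..<d}. decreasing_lists k j)"
    by (auto simp: inj_on_def)
next
  fix ds assume "ds \<in> (\<lambda>(j, ds). j # ds) ` (SIGMA j:{..<d}. decreasing_lists k j)"
  then show "ds \<in> decreasing_lists (Suc k) d"
    by (force simp: decreasing_lists_def)
next
  fix ds assume "ds \<in> decreasing_lists (Suc k) d"
  then show "ds \<in> (\<lambda>(j, ds). j # ds) ` (SIGMA j:{..<d}. decreasing_lists k j)"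
    by (cases ds) (force simp: decreasing_lists_def)+
qed

lemma finite_decreasing_lists: "finite (decreasing_lists k d)"
proof (induction k arbitrary: d)
  case (Suc k)
  then show ?case
    using bij_betw_finite[OF bij_betw_decreasing_lists_Suc[of d k]] by (simp add: finite_SigmaI)
qed (simp add: decreasing_lists_0)

lemma sum_decreasing_lists:
  "(\<Sum>ds\<in>decreasing_lists (length ss) d. \<Prod>i<length ss. S (ds ! i) (ss ! i))
    = (S_less ss d :: 'a::{field,finite} fls)"
proof (induction ss arbitrary: d)
  case (Cons s ss)
  have "(\<Sum>ds\<in>decreasing_lists (length (s # ss)) d. \<Prod>i<length (s # ss). S (ds ! i) ((s # ss) ! i) :: 'a fls)
      = (\<Sum>x\<in>(SIGMA j:{..<d}. decreasing_lists (length ss) j).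
          S (fst x) s * (\<Prod>i<length ss. S (snd x ! i) (ss ! i)))"
    by (unfold length_Cons, subst sum.reindex_bij_betw[OF bij_betw_decreasing_lists_Suc[of d "length ss"], symmetric])
      (simp_all add: case_prod_unfold prod.lessThan_Suc_shift del: prod.lessThan_Suc)
  also have "\<dots> = (\<Sum>j<d. \<Sum>ds\<in>decreasing_lists (length ss) j.
          S j s * (\<Prod>i<length ss. S (ds ! i) (ss ! i)))"
    by (subst sum.Sigma) (simp_all add: finite_decreasing_lists case_prod_unfold)
  also have "\<dots> = S_less (s # ss) d"
    by (simp add: Cons.IH flip: sum_distrib_left)
  finally show ?case .
qed (simp add: decreasing_lists_0)

text \<open>Up to the sign \<open>(- 1)^k\<close> this is the inverse of Carlitz's D_k, the product
  of \<open>theta^(q^k) - theta^(q^i)\<close> over \<open>i < k\<close>.\<close>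

definition telescope_coeff :: "nat \<Rightarrow> 'a::{field,finite} fls" where
  "telescope_coeff k = (\<Prod>j=1..k. inverse (theta - theta ^ (CARD('a) ^ j)) ^ (CARD('a) ^ (k - j)))"

text \<open>The intended closed form of the truncated sum for the exponents
  \<open>q - 1, (q - 1) q, ..., (q - 1) q^(k - 1)\<close>. It is 0 for \<open>d < k\<close>, as no
  \<open>k\<close> distinct degrees fit below \<open>d\<close>.\<close>

definition S_less_base :: "nat \<Rightarrow> nat \<Rightarrow> 'a::{field,finite} fls" where
  "S_less_base k d = (if d < k then 0 else telescope_coeff k * ell d / ell (d - k) ^ (CARD('a) ^ k))"

text \<open>Carlitz's recursion D_(k+1) = [k+1] D_k^q, inverted.\<close>

lemma telescope_coeff_Suc:
  "telescope_coeff (Suc k) * (theta - theta ^ (CARD('a) ^ Suc k)) = (telescope_coeff k :: 'a::{field,finite} fls) ^ CARD('a)"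
proof -
  have "(telescope_coeff k :: 'a fls) ^ CARD('a) =
      (\<Prod>j=1..k. inverse (theta - theta ^ (CARD('a) ^ j)) ^ (CARD('a) ^ (Suc k - j)))"
    unfolding telescope_coeff_def prod_power_distrib
    by (intro prod.cong refl) (simp add: Suc_diff_le mult.commute flip: power_mult)
  moreover have "telescope_coeff (Suc k) = (\<Prod>j=1..k. inverse (theta - theta ^ (CARD('a) ^ j)) ^ (CARD('a) ^ (Suc k - j)))
      * inverse (theta - theta ^ (CARD('a) ^ Suc k) :: 'a fls)"
    unfolding telescope_coeff_def by simp
  ultimately show ?thesis using theta_diff_nonzero[of "Suc k", where 'a='a] by simp
qed

context finite_constants
begin

text \<open>This is the telescoping: the increment in \<open>d\<close> is \<open>S d (q - 1)\<close>
  times the \<open>q\<close>-th power of the shorter sum. For \<open>d > k\<close>, after clearing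
  common factors, it is the identity \<open>x - z = (y - z) + (x - y)\<close>.\<close>

lemma S_less_base_rec:
  "S_less_base (Suc k) (Suc d) =
    S_less_base (Suc k) d + ell d / ell d ^ CARD('a) * (S_less_base k d :: 'a fls) ^ CARD('a)"
proof -
  consider "d < k" | "d = k" | t where "d = Suc (k + t)"
    by (metis add_Suc_right less_iff_Suc_add nat_neq_iff)
  then show ?thesis
  proof cases
    case 1
    then show ?thesis by (simp add: S_less_base_def)
  next
    \<comment> \<open>The first nonzero value: the earlier partial sum is still 0, and the claim
      reduces to \<open>telescope_coeff_Suc\<close>.\<close>
    case 2
    have "(ell d :: 'a fls) / ell d ^ CARD('a) * (telescope_coeff d * ell d) ^ CARD('a) = ell d * telescope_coeff d ^ CARD('a)"
      by (simp add: power_mult_distrib)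
    then show ?thesis
      using 2 telescope_coeff_Suc[of d, where 'a='a] by (simp add: S_less_base_def ell_Suc mult_ac)
  next
    case 3
    define x y z :: "'a fls" where "x = theta" and "y = theta ^ (CARD('a) ^ Suc k)"
      and "z = theta ^ (CARD('a) ^ Suc d)"
    define F :: "'a fls" where "F = ell t ^ (CARD('a) ^ Suc k)"
    have "F \<noteq> 0" by (simp add: F_def)
    have ell_t: "ell (Suc t) ^ (CARD('a) ^ Suc k) = F * (y - z)"
    proof -
      have "(theta ^ (CARD('a) ^ Suc t)) ^ (CARD('a) ^ Suc k) = z"
        unfolding z_def 3 by (simp only: power_mult[symmetric] power_add[symmetric]) (simp add: ac_simps)
      then show ?thesis
        unfolding ell_Suc power_mult_distrib q_frobenius_diff F_def y_def by simp
    qed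
    have "y - z \<noteq> 0"
      using ell_t ell_nonzero[of "Suc t", where 'a='a] by (metis mult_zero_right power_not_zero)
    have "(S_less_base k d :: 'a fls) ^ CARD('a) = telescope_coeff k ^ CARD('a) * ell d ^ CARD('a) / (F * (y - z))"
      using 3 by (simp add: S_less_base_def power_mult_distrib power_divide ell_t[symmetric] mult.commute flip: power_mult)
    also have "telescope_coeff k ^ CARD('a) = telescope_coeff (Suc k) * (x - y)"
      by (simp only: telescope_coeff_Suc x_def y_def)
    finally have "ell d / ell d ^ CARD('a) * (S_less_base k d :: 'a fls) ^ CARD('a)
        = telescope_coeff (Suc k) * ell d * (x - y) / (F * (y - z))" by simp
    moreover have "S_less_base (Suc k) (Suc d) = telescope_coeff (Suc k) * ell d * (x - z) / (F * (y - z))"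
    proof -
      have "\<not> Suc d < Suc k" "Suc d - Suc k = Suc t" using 3 by simp_all
      then have "S_less_base (Suc k) (Suc d) = telescope_coeff (Suc k) * ell (Suc d) / (F * (y - z))"
        by (simp only: S_less_base_def ell_t if_False)
      then show ?thesis by (simp only: ell_Suc x_def z_def mult.assoc)
    qed
    moreover have "S_less_base (Suc k) d = telescope_coeff (Suc k) * ell d / F"
      using 3 by (simp add: S_less_base_def F_def)
    moreover have "telescope_coeff (Suc k) * ell d / F = telescope_coeff (Suc k) * ell d * (y - z) / (F * (y - z))"
      using \<open>y - z \<noteq> 0\<close> by simp
    ultimately show ?thesis
      by (simp only: add_divide_distrib[symmetric] distrib_left[symmetric]) simp
  qed
qed

lemma S_less_base_0: "S_less_base (Suc k) 0 = 0"
  by (simp add: S_less_base_def)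

text \<open>The one-digit case of \<open>S_eq_ell\<close>: position 0 carries the digit 1.\<close>

lemma S_q_minus_1: "S d (int (CARD('a) - 1)) = (ell d / ell d ^ CARD('a) :: 'a fls)"
  using S_eq_ell[of "\<lambda>_. 1" 1 d] CARD_gt_1[where 'a='a] by (simp add: of_nat_diff)

lemma S_q_minus_1_mult:
  "S d (int (CHAR('a) ^ m * (CARD('a) - 1) * CARD('a) ^ e)) =
    (ell d / ell d ^ CARD('a) :: 'a fls) ^ (CHAR('a) ^ m * CARD('a) ^ e)"
proof -
  have *: "CHAR('a) ^ m * CARD('a) ^ e = CHAR('a) ^ (m + l * e)"
    by (simp only: power_add q_power_eq)
  have "int (CHAR('a) ^ m * (CARD('a) - 1) * CARD('a) ^ e) =
      int (CHAR('a) ^ (m + l * e)) * int (CARD('a) - 1)"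
    unfolding *[symmetric] by (simp only: of_nat_mult mult_ac)
  then show ?thesis by (simp only: S_frobenius[symmetric] S_q_minus_1 *)
qed

text \<open>The exponents are \<open>p^m q^b\<close> times those of the base case, so the value is a
  Frobenius power of the base value. The outer induction is on the length, the inner one on
  \<open>d\<close>.\<close>

lemma S_less_eq_base:
  "S_less (map (\<lambda>e. int (CHAR('a) ^ m * (CARD('a) - 1) * CARD('a) ^ e)) [b..<b + k]) d
    = (S_less_base k d :: 'a fls) ^ (CHAR('a) ^ m * CARD('a) ^ b)"
proof (induction k arbitrary: b d)
  case 0
  then show ?case by (simp add: S_less_base_def telescope_coeff_def)
next
  case (Suc k)
  note IH = Suc.IH
  \<comment> \<open>The tail starts at \<open>Suc b\<close>; the hypothesis, general in
    \<open>b\<close>, then supplies the extra \<open>q\<close>-th power that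
    \<open>S_less_base_rec\<close> requires.\<close>
  have list: "[b..<b + Suc k] = b # [Suc b..<Suc b + k]" by (simp add: upt_conv_Cons)
  have "CHAR('a) ^ m * CARD('a) ^ b = CHAR('a) ^ (m + l * b)"
    by (simp add: power_add q_power_eq)
  note frob = fls_frobenius_add[where 'a='a and m="m + l * b", folded this]
  show ?case
  proof (induction d)
    case 0
    then show ?case
      unfolding list list.map S_less.simps S_less_base_0
      using prime_gt_0_nat[OF finite_field_prime_CHAR[where 'a='a]] by (simp add: power_0_left)
  next
    case (Suc d)
    have "S_less (map (\<lambda>e. int (CHAR('a) ^ m * (CARD('a) - 1) * CARD('a) ^ e)) [b..<b + Suc k]) (Suc d)
      = (S_less_base (Suc k) d :: 'a fls) ^ (CHAR('a) ^ m * CARD('a) ^ b) +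
        (ell d / ell d ^ CARD('a)) ^ (CHAR('a) ^ m * CARD('a) ^ b) *
        S_less_base k d ^ (CHAR('a) ^ m * CARD('a) ^ Suc b)"
      using Suc.IH unfolding list list.map S_less.simps sum.lessThan_Suc S_q_minus_1_mult IH by simp
    also have "S_less_base k d ^ (CHAR('a) ^ m * CARD('a) ^ Suc b) =
        ((S_less_base k d :: 'a fls) ^ CARD('a)) ^ (CHAR('a) ^ m * CARD('a) ^ b)"
      by (simp add: ac_simps flip: power_mult)
    finally show ?case
      by (simp only: S_less_base_rec frob power_mult_distrib)
  qed
qed

end

subsection \<open>Convergence\<close>

lemma fls_dist_leI:
  fixes a b :: "'a::field fls"
  assumes "\<And>k. k < int N \<Longrightarrow> a $$ k = b $$ k"
  shows "dist a b \<le> inverse (2 ^ N)"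
proof (cases "a = b")
  case False
  then have "int N \<le> fls_subdegree (a - b)"
    using assms by (intro fls_subdegree_geI) auto
  then have "(2::real) ^ N \<le> 2 ^ nat (fls_subdegree (a - b))"
    by (intro power_increasing) auto
  then show ?thesis
    using False \<open>int N \<le> fls_subdegree (a - b)\<close> by (simp add: dist_fls_def)
qed simp

lemma fls_dist_lessD:
  fixes a b :: "'a::field fls"
  assumes "dist a b < inverse (2 ^ N)" "k < int N"
  shows "a $$ k = b $$ k"
proof (cases "a = b")
  case False
  have *: "fls_subdegree (a - b) \<ge> 0"
  proof (rule ccontr)
    assume "\<not> fls_subdegree (a - b) \<ge> 0"
    then have "dist a b \<ge> 1" using False by (simp add: dist_fls_def)
    moreover have "inverse (2 ^ N) \<le> (1::real)" by (simp add: field_simps)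
    ultimately show False using assms by simp
  qed
  then have "(2::real) ^ N < 2 ^ nat (fls_subdegree (a - b))"
    using assms(1) False by (simp add: dist_fls_def)
  then have "int N < fls_subdegree (a - b)" by simp
  then have "(a - b) $$ k = 0" using assms(2) by (intro fls_eq0_below_subdegree) simp
  then show ?thesis by simp
qed simp

text \<open>Distances are powers of 2 governed by the first differing coefficient, so convergence
  means that all coefficients below any bound eventually stabilise.\<close>

lemma tendsto_fls_iff:
  fixes f :: "'b \<Rightarrow> 'a::field fls"
  shows "(f \<longlongrightarrow> z) F \<longleftrightarrow> (\<forall>N. \<forall>\<^sub>F x in F. \<forall>k<N. f x $$ k = z $$ k)"
proof
  assume *: "(f \<longlongrightarrow> z) F"
  show "\<forall>N. \<forall>\<^sub>F x in F. \<forall>k<N. f x $$ k = z $$ k"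
  proof
    fix N :: int
    have "\<forall>\<^sub>F x in F. dist (f x) z < inverse (2 ^ nat N)"
      using * by (rule tendstoD) simp
    then show "\<forall>\<^sub>F x in F. \<forall>k<N. f x $$ k = z $$ k"
      by eventually_elim (use fls_dist_lessD in fastforce)
  qed
next
  assume *: "\<forall>N. \<forall>\<^sub>F x in F. \<forall>k<N. f x $$ k = z $$ k"
  show "(f \<longlongrightarrow> z) F"
  proof (rule tendstoI)
    fix e :: real assume "e > 0"
    then obtain N where N: "inverse (2 ^ N) < e"
      using real_arch_pow_inv[of e "1/2"] by (auto simp: power_one_over inverse_eq_divide)
    from * have "\<forall>\<^sub>F x in F. \<forall>k<int N. f x $$ k = z $$ k" by blast
    then show "\<forall>\<^sub>F x in F. dist (f x) z < e"
    proof eventually_elim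
      case (elim x)
      then have "dist (f x) z \<le> inverse (2 ^ N)" by (intro fls_dist_leI) blast
      with N show ?case by simp
    qed
  qed
qed

text \<open>Valuation at least \<open>N\<close>, phrased by coefficients so that the zero series
  qualifies for every \<open>N\<close> although its \<open>fls_subdegree\<close> is 0.\<close>

definition vanishes_below :: "int \<Rightarrow> 'a::zero fls \<Rightarrow> bool" where
  "vanishes_below N x \<longleftrightarrow> (\<forall>k<N. x $$ k = 0)"

lemma vanishes_below_mono: "vanishes_below N x \<Longrightarrow> M \<le> N \<Longrightarrow> vanishes_below M x"
  by (simp add: vanishes_below_def)

lemma vanishes_below_subdegree: "vanishes_below (fls_subdegree x) x"
  by (simp add: vanishes_below_def)

lemma vanishes_below_sum: "(\<And>i. i \<in> I \<Longrightarrow> vanishes_below N (f i)) \<Longrightarrow> vanishes_below N (sum f I)"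
  by (simp add: vanishes_below_def fls_nth_sum)

lemma vanishes_below_mult:
  fixes x y :: "'a::field fls"
  assumes "vanishes_below M x" "vanishes_below N y"
  shows "vanishes_below (M + N) (x * y)"
proof (cases "x = 0 \<or> y = 0")
  case False
  then have "M \<le> fls_subdegree x" "N \<le> fls_subdegree y"
    using assms by (auto simp: vanishes_below_def intro: fls_subdegree_geI)
  then show ?thesis by (auto simp: vanishes_below_def intro!: fls_times_nth_eq0)
qed (auto simp: vanishes_below_def)

lemma vanishes_below_prod:
  fixes f :: "'i \<Rightarrow> 'a::field fls"
  assumes "\<And>i. i \<in> I \<Longrightarrow> vanishes_below (N i) (f i)" "finite I"
  shows "vanishes_below (\<Sum>i\<in>I. N i) (\<Prod>i\<in>I. f i)"
  using assms(2,1)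
  by (induction I rule: finite_induct)
    (auto intro: vanishes_below_mult simp: vanishes_below_def[of 0 1])

text \<open>Multiplication by \<open>R\<close> shifts valuations by at least
  \<open>fls_subdegree R\<close>, so it suffices to control coefficients up to a shifted
  bound.\<close>

lemma tendsto_fls_mult_left:
  fixes f :: "'b \<Rightarrow> 'a::field fls"
  assumes "(f \<longlongrightarrow> z) F"
  shows "((\<lambda>x. R * f x) \<longlongrightarrow> R * z) F"
  unfolding tendsto_fls_iff
proof
  fix N
  have "\<forall>\<^sub>F x in F. \<forall>k<N - fls_subdegree R. f x $$ k = z $$ k"
    using assms by (simp add: tendsto_fls_iff)
  then show "\<forall>\<^sub>F x in F. \<forall>k<N. (R * f x) $$ k = (R * z) $$ k"
  proof eventually_elim
    case (elim x)
    then have "vanishes_below (N - fls_subdegree R) (f x - z)" by (simp add: vanishes_below_def)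
    from vanishes_below_mult[OF vanishes_below_subdegree[of R] this]
    show ?case by (simp add: vanishes_below_def right_diff_distrib)
  qed
qed

text \<open>
  In a non-archimedean field, terms tending to zero make all orders of summation equivalent; this
  holds whether or not the sum converges, so completeness is not involved.
\<close>
lemma has_sum_fls_iff:
  fixes f :: "'b \<Rightarrow> 'a::field fls" and deg :: "'b \<Rightarrow> nat"
  assumes fin: "\<And>M. finite {x \<in> X. deg x < M}"
    and small: "\<And>x. x \<in> X \<Longrightarrow> vanishes_below (int (deg x)) (f x)"
  shows "(f has_sum z) X \<longleftrightarrow> (\<lambda>M. \<Sum>x\<in>{x \<in> X. deg x < M}. f x) \<longlonglongrightarrow> z"
proof
  assume "(f has_sum z) X"
  then have "(sum f \<longlongrightarrow> z) (finite_subsets_at_top X)" by (simp add: has_sum_def)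
  moreover have "filterlim (\<lambda>M. {x \<in> X. deg x < M}) (finite_subsets_at_top X) sequentially"
    unfolding filterlim_finite_subsets_at_top
  proof (intro allI impI)
    fix Y assume Y: "finite Y \<and> Y \<subseteq> X"
    show "\<forall>\<^sub>F M in sequentially. finite {x \<in> X. deg x < M} \<and> Y \<subseteq> {x \<in> X. deg x < M} \<and> {x \<in> X. deg x < M} \<subseteq> X"
    proof (rule eventually_sequentiallyI[of "Suc (Max (deg ` Y))"])
      fix M assume M: "Suc (Max (deg ` Y)) \<le> M"
      have "deg x < M" if "x \<in> Y" for x
      proof -
        have "deg x \<le> Max (deg ` Y)" using Y that by (intro Max_ge) auto
        with M show ?thesis by linarith
      qed
      then show "finite {x \<in> X. deg x < M} \<and> Y \<subseteq> {x \<in> X. deg x < M} \<and> {x \<in> X. deg x < M} \<subseteq> X"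
        using Y fin by auto
    qed
  qed
  ultimately show "(\<lambda>M. \<Sum>x\<in>{x \<in> X. deg x < M}. f x) \<longlonglongrightarrow> z"
    by (rule filterlim_compose)
next
  assume lim: "(\<lambda>M. \<Sum>x\<in>{x \<in> X. deg x < M}. f x) \<longlonglongrightarrow> z"
  show "(f has_sum z) X"
    unfolding has_sum_def tendsto_fls_iff
  proof
    fix N
    \<comment> \<open>With \<open>M \<ge> N\<close>, terms of degree at least \<open>M\<close>
      cannot affect coefficients below \<open>N\<close>; any finite set containing the first block
      therefore has the same low coefficients.\<close>
    have "\<forall>\<^sub>F M in sequentially. (\<forall>k<N. (\<Sum>x\<in>{x \<in> X. deg x < M}. f x) $$ k = z $$ k) \<and> int M \<ge> N"
      using lim unfolding tendsto_fls_iff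
      by (intro eventually_conj) (auto intro: eventually_sequentiallyI[of "nat N"])
    then obtain M where M: "\<And>k. k < N \<Longrightarrow> (\<Sum>x\<in>{x \<in> X. deg x < M}. f x) $$ k = z $$ k" "int M \<ge> N"
      unfolding eventually_sequentially by blast
    show "\<forall>\<^sub>F Y in finite_subsets_at_top X. \<forall>k<N. sum f Y $$ k = z $$ k"
      unfolding eventually_finite_subsets_at_top
    proof (intro exI[of _ "{x \<in> X. deg x < M}"] conjI allI impI)
      fix Y k assume Y: "finite Y \<and> {x \<in> X. deg x < M} \<subseteq> Y \<and> Y \<subseteq> X" and k: "k < N"
      have "sum f Y $$ k = (\<Sum>x\<in>Y. f x $$ k)" by (simp add: fls_nth_sum)
      also have "\<dots> = (\<Sum>x\<in>{x \<in> X. deg x < M}. f x $$ k)"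
      proof (rule sum.mono_neutral_right)
        show "\<forall>x\<in>Y - {x \<in> X. deg x < M}. f x $$ k = 0"
        proof
          fix x assume "x \<in> Y - {x \<in> X. deg x < M}"
          then have "x \<in> X" "M \<le> deg x" using Y by auto
          then show "f x $$ k = 0" using small[of x] M(2) k by (simp add: vanishes_below_def)
        qed
      qed (use Y in auto)
      finally show "sum f Y $$ k = z $$ k" using M(1)[OF k] by (simp add: fls_nth_sum)
    qed (use fin in auto)
  qed
qed

section \<open>Zeta and multizeta values as limits of sums ordered by degree\<close>

lemma vanishes_below_emb_powi:
  assumes "s \<ge> 0"
  shows "vanishes_below (int (degree a) * s) (emb a powi (- s))"
  using vanishes_below_subdegree[of "emb a powi (- s)"]
  by (simp add: fls_subdegree_emb mult.commute)

lemma vanishes_below_S: "s \<ge> 0 \<Longrightarrow> vanishes_below (int d * s) (S d s)"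
  unfolding S_def by (rule vanishes_below_sum) (use vanishes_below_emb_powi in force)

lemma zeta_has_sum_iff:
  fixes z :: "'a::{field,finite} fls"
  assumes "w > 0"
  shows "((\<lambda>a. emb a powi (- w)) has_sum z) monics \<longleftrightarrow> (\<lambda>M. \<Sum>d<M. S d w) \<longlonglongrightarrow> z"
proof -
  have Un: "{a \<in> monics. degree a < M} = (\<Union>d<M. monics_of_degree d :: 'a poly set)" for M by auto
  have "(\<Sum>a\<in>{a \<in> monics. degree a < M}. emb (a::'a poly) powi (- w)) = (\<Sum>d<M. S d w)" for M
    unfolding Un S_def by (rule sum.UNION_disjoint) (auto simp: finite_monics_of_degree)
  moreover have "finite {a::'a poly \<in> monics. degree a < M}" for M
    unfolding Un by (simp add: finite_monics_of_degree)
  moreover have "vanishes_below (int (degree a)) (emb a powi (- w))" for a :: "'a poly"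
    using assms by (intro vanishes_below_mono[OF vanishes_below_emb_powi]) (auto simp: mult_le_cancel_left1)
  ultimately show ?thesis
    using has_sum_fls_iff[of monics degree "\<lambda>a. emb a powi (- w)" z] by simp
qed

text \<open>Tuples are ordered by their head, the largest degree. A term has valuation at least the
  sum of the \<open>ds ! i * ss ! i\<close>, hence at least \<open>hd ds\<close>, because the
  exponents are positive.\<close>

lemma multizeta_has_sum_iff:
  fixes z :: "'a::{field,finite} fls"
  assumes "ss \<noteq> []" "\<forall>s\<in>set ss. s > 0"
  shows "((\<lambda>ds. \<Prod>i<length ss. S (ds ! i) (ss ! i)) has_sum z)
      {ds. length ds = length ss \<and> sorted_wrt (>) ds} \<longleftrightarrow> (\<lambda>M. S_less ss M) \<longlonglongrightarrow> z"
    (is "(?f has_sum z) ?X \<longleftrightarrow> _")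
proof -
  have eq: "{ds \<in> ?X. hd ds < M} = decreasing_lists (length ss) M" for M
  proof (intro equalityI subsetI)
    fix ds assume "ds \<in> {ds \<in> ?X. hd ds < M}"
    then show "ds \<in> decreasing_lists (length ss) M"
      by (cases ds) (auto simp: decreasing_lists_def)
  next
    fix ds assume "ds \<in> decreasing_lists (length ss) M"
    then show "ds \<in> {ds \<in> ?X. hd ds < M}"
      using assms(1) by (cases ds) (auto simp: decreasing_lists_def)
  qed
  have small: "vanishes_below (int (hd ds)) (?f ds)" if "ds \<in> ?X" for ds
  proof -
    have len: "0 < length ss" using assms(1) by simp
    have ssi: "ss ! i > 0" if "i < length ss" for i using assms(2) that by simp
    have "vanishes_below (\<Sum>i<length ss. int (ds ! i) * ss ! i) (?f ds)"
      using ssi by (intro vanishes_below_prod vanishes_below_S) (auto intro: less_imp_le)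
    moreover have "int (hd ds) \<le> (\<Sum>i<length ss. int (ds ! i) * ss ! i)"
    proof -
      have "int (hd ds) \<le> int (ds ! 0) * ss ! 0"
        using that len ssi[OF len] by (cases ds) (auto simp: mult_le_cancel_left1)
      also have "\<dots> \<le> (\<Sum>i<length ss. int (ds ! i) * ss ! i)"
        using len ssi by (intro member_le_sum) (auto simp: less_imp_le)
      finally show ?thesis .
    qed
    ultimately show ?thesis by (rule vanishes_below_mono)
  qed
  show ?thesis
    using has_sum_fls_iff[of ?X hd ?f z, unfolded eq, OF finite_decreasing_lists small]
    unfolding sum_decreasing_lists .
qed

text \<open>Termwise proportionality with an index shift of \<open>k\<close> passes to the partial
  sums and so to the limits. As \<open>R\<close> is invertible, the two families are summable
  together.\<close>

lemma multizeta_eq_mult_zeta: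
  fixes R :: "'a::{field,finite} fls"
  assumes pos: "\<forall>s\<in>set (s1 # ss). s > 0" "w > 0" and R: "R \<noteq> 0"
    and zero: "\<And>d. d < k \<Longrightarrow> S d s1 * S_less ss d = (0 :: 'a fls)"
    and shift: "\<And>d. S (d + k) s1 * S_less ss (d + k) = R * S d w"
  shows "multizeta (s1 # ss) = R * zeta w"
proof -
  have partial: "S_less (s1 # ss) (M + k) = R * (\<Sum>d<M. S d w)" for M
  proof (induction M)
    case 0
    have "(\<Sum>d<k. S d s1 * S_less ss d) = (0 :: 'a fls)"
      by (intro sum.neutral) (use zero in blast)
    then show ?case by simp
  next
    case (Suc M)
    then show ?case using shift[of M] by (simp add: distrib_left)
  qed
  let ?X = "{ds. length ds = length (s1 # ss) \<and> sorted_wrt (>) ds}"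
  let ?f = "\<lambda>ds. \<Prod>i<length (s1 # ss). S (ds ! i) ((s1 # ss) ! i) :: 'a fls"
  let ?g = "\<lambda>a::'a poly. emb a powi (- w)"
  have iff: "(?f has_sum R * z) ?X \<longleftrightarrow> (?g has_sum z) monics" for z
  proof -
    have "(?f has_sum R * z) ?X \<longleftrightarrow> (\<lambda>M. S_less (s1 # ss) M) \<longlonglongrightarrow> R * z"
      using pos(1) by (intro multizeta_has_sum_iff) auto
    also have "\<dots> \<longleftrightarrow> (\<lambda>M. S_less (s1 # ss) (M + k)) \<longlonglongrightarrow> R * z"
      using LIMSEQ_ignore_initial_segment LIMSEQ_offset by blast
    also have "\<dots> \<longleftrightarrow> (\<lambda>M. \<Sum>d<M. S d w) \<longlonglongrightarrow> z"
    proof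
      assume "(\<lambda>M. S_less (s1 # ss) (M + k)) \<longlonglongrightarrow> R * z"
      from tendsto_fls_mult_left[OF this, of "inverse R"]
      show "(\<lambda>M. \<Sum>d<M. S d w) \<longlonglongrightarrow> z" using R by (simp only: partial) (simp add: mult.assoc[symmetric])
    next
      assume "(\<lambda>M. \<Sum>d<M. S d w) \<longlonglongrightarrow> z"
      then show "(\<lambda>M. S_less (s1 # ss) (M + k)) \<longlonglongrightarrow> R * z"
        by (simp only: partial tendsto_fls_mult_left)
    qed
    also have "\<dots> \<longleftrightarrow> (?g has_sum z) monics" using pos(2) by (rule zeta_has_sum_iff[symmetric])
    finally show ?thesis .
  qed
  show ?thesis
  proof (cases "?g summable_on monics")
    case True
    then have "(?f has_sum R * zeta w) ?X" unfolding iff zeta_def by (rule has_sum_infsum)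
    then show ?thesis unfolding multizeta_def by (rule infsumI)
  next
    \<comment> \<open>Without summability both infinite sums take the default value 0, so the
      equation persists.\<close>
    case False
    have "\<not> ?f summable_on ?X"
    proof
      assume "?f summable_on ?X"
      then obtain z where "(?f has_sum z) ?X" by (auto simp: summable_on_def)
      then have "(?f has_sum R * (z / R)) ?X" using R by simp
      then show False using False iff summable_on_def by blast
    qed
    then show ?thesis
      unfolding multizeta_def zeta_def by (simp only: infsum_not_exists False not_False_eq_True mult_zero_right)
  qed
qed

subsection \<open>The field K\<close>

lemma K_field_emb [simp]: "emb a \<in> K_field"
  unfolding K_field_def by (intro CollectI exI[of _ a] exI[of _ 1]) simp

lemma K_field_1 [simp]: "1 \<in> K_field"
  using K_field_emb[of 1] by simp

lemma K_field_0 [simp]: "0 \<in> K_field"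
  using K_field_emb[of 0] by simp

lemma K_field_mult: "x \<in> K_field \<Longrightarrow> y \<in> K_field \<Longrightarrow> x * y \<in> K_field"
  unfolding K_field_def
proof clarify
  fix a b c d :: "'a poly" assume "b \<noteq> 0" "d \<noteq> 0"
  then show "\<exists>aa ba. emb a / emb b * (emb c / emb d) = emb aa / emb ba \<and> ba \<noteq> 0"
    by (intro exI[of _ "a * c"] exI[of _ "b * d"]) (simp add: emb_mult)
qed

lemma K_field_inverse: "x \<in> K_field \<Longrightarrow> inverse x \<in> K_field"
  unfolding K_field_def
proof clarify
  fix a b :: "'a poly" assume "b \<noteq> 0"
  then show "\<exists>aa ba. inverse (emb a / emb b) = emb aa / emb ba \<and> ba \<noteq> 0"
  proof (cases "a = 0")
    case True
    then show ?thesis by (intro exI[of _ 0] exI[of _ 1]) simp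
  qed (intro exI[of _ b] exI[of _ a], simp)
qed

lemma K_field_divide: "x \<in> K_field \<Longrightarrow> y \<in> K_field \<Longrightarrow> x / y \<in> K_field"
  by (simp add: divide_inverse K_field_mult K_field_inverse)

lemma K_field_power: "x \<in> K_field \<Longrightarrow> x ^ n \<in> K_field"
  by (induction n) (simp_all add: K_field_mult)

lemma K_field_prod: "(\<And>i. i \<in> I \<Longrightarrow> f i \<in> K_field) \<Longrightarrow> (\<Prod>i\<in>I. f i) \<in> K_field"
  by (induction I rule: infinite_finite_induct) (simp_all add: K_field_mult)

lemma K_field_theta_diff: "theta - theta ^ j \<in> (K_field :: 'a::field fls set)"
proof -
  have "(theta :: 'a fls) - theta ^ j = emb ([:0, 1:] - [:0, 1:] ^ j)"
    by (simp add: emb_diff emb_power)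
  then show ?thesis by (simp only: K_field_emb)
qed

lemma K_field_ell: "ell d \<in> K_field"
  unfolding ell_def by (intro K_field_prod K_field_theta_diff)

lemma K_field_telescope_coeff: "telescope_coeff k \<in> K_field"
  unfolding telescope_coeff_def by (intro K_field_prod K_field_power K_field_inverse K_field_theta_diff)

subsection \<open>The ratio of the two values\<close>

lemma bracket_conv_theta: "theta - theta ^ (CARD('a) ^ j) = - (bracket j :: 'a::{field,finite} fls)"
  by (simp add: bracket_def)

context finite_constants
begin

text \<open>Additivity of Frobenius covers odd characteristic and characteristic 2, where
  \<open>- 1 = 1\<close>, at once.\<close>

lemma minus_one_power_CHAR: "(- 1 :: 'a fls) ^ (CHAR('a) ^ j) = - 1"
  using fls_frobenius_diff[of "0 :: 'a fls" 1 j] prime_gt_0_nat[OF finite_field_prime_CHAR[where 'a='a]]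
  by (simp add: power_0_left)

lemma minus_one_power_q: "(- 1 :: 'a fls) ^ (CARD('a) ^ j) = - 1"
  unfolding q_power_eq by (rule minus_one_power_CHAR)

text \<open>The factor between corresponding terms, still written with \<open>ell\<close>. Here
  \<open>N\<close> holds the digits of \<open>s1\<close>, \<open>M\<close> those of
  \<open>w\<close>, and \<open>k\<close> is \<open>r - 1\<close>.\<close>

definition zeta_ratio :: "nat \<Rightarrow> nat \<Rightarrow> nat \<Rightarrow> (nat \<Rightarrow> nat) \<Rightarrow> (nat \<Rightarrow> nat) \<Rightarrow> 'a fls" where
  "zeta_ratio n k m N M = telescope_coeff k ^ (CHAR('a) ^ m * CARD('a) ^ (n - 1)) *
    ((\<Prod>i<n. ell (n + k - 1 - i) ^ (M i * CARD('a) ^ i)) / (\<Prod>i<n. ell (n - 1 - i) ^ (N i * CARD('a) ^ i)))"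

text \<open>Write \<open>p^m q^(n + k - 1)\<close> as
  \<open>q^(n + k) - (q - p^m) q^(n + k - 1)\<close>. The part \<open>q - p^m\<close> of the digit
  at \<open>n - 1\<close> moves to the top position, so the digit sum is unchanged and
  \<open>S_eq_ell\<close> applies.\<close>

lemma S_carry:
  assumes "n \<ge> 1" "k \<ge> 1" "CHAR('a) ^ m \<le> CARD('a)"
    and N: "\<And>i. i < n \<Longrightarrow> N i = M i + (if i = n - 1 then CARD('a) - CHAR('a) ^ m else 0)"
    and sum: "(\<Sum>i<n. N i) \<le> CARD('a) - 1"
  shows "S d (int (CHAR('a) ^ m * CARD('a) ^ (n + k - 1)) - (\<Sum>i<n. int (M i * CARD('a) ^ i)))
    = (\<Prod>i<n. (ell (n + k - 1 - i + d) / ell (n + k - 1 - i)) ^ (M i * CARD('a) ^ i)) /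
      (ell d :: 'a fls) ^ (CHAR('a) ^ m * CARD('a) ^ (n + k - 1))"
proof -
  define P where "P = CHAR('a) ^ m"
  define q where "q = CARD('a)"
  have Pq: "P \<le> q" using assms by (simp add: P_def q_def)
  \<comment> \<open>Positions from \<open>n\<close> to \<open>n + k - 2\<close> hold 0. The top
    position contributes a power of \<open>ell d / ell 0 = ell d\<close>, which cancels part of the
    denominator.\<close>
  define N2 where "N2 i = (if i < n then M i else if i = n + k - 1 then q - P else 0)" for i
  have split: "{..<n + k} = {..<n} \<union> {n..<n + k - 1} \<union> {n + k - 1}" using assms by auto
  have sum_split: "(\<Sum>i<n + k. N2 i * f i) = (\<Sum>i<n. M i * f i) + (q - P) * f (n + k - 1)" for f :: "nat \<Rightarrow> nat"
    unfolding split using assms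
    by (subst sum.union_disjoint; (subst sum.union_disjoint)?) (auto simp: N2_def)
  have "(\<Sum>i<n. N i) = (\<Sum>i<n. M i) + (q - P)"
    using N \<open>n \<ge> 1\<close> by (simp add: sum.distrib P_def q_def)
  then have le: "(\<Sum>i<n + k. N2 i) \<le> CARD('a) - 1"
    using sum sum_split[of "\<lambda>_. 1"] by simp
  have qn: "q ^ (n + k) = q * q ^ (n + k - 1)" using assms by (cases "n + k") auto
  have exps: "q ^ (n + k) = (q - P) * q ^ (n + k - 1) + P * q ^ (n + k - 1)"
    using Pq unfolding qn by (simp flip: distrib_right)
  have "int (q ^ (n + k)) - (\<Sum>i<n + k. int (N2 i * q ^ i)) =
      int (P * q ^ (n + k - 1)) - (\<Sum>i<n. int (M i * q ^ i))"
    unfolding of_nat_sum[symmetric] sum_split[of "\<lambda>i. q ^ i"] exps by simp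
  then have "S d (int (P * q ^ (n + k - 1)) - (\<Sum>i<n. int (M i * q ^ i))) =
      (S d (int (q ^ (n + k)) - (\<Sum>i<n + k. int (N2 i * q ^ i))) :: 'a fls)" by simp
  also have "\<dots> = (\<Prod>i<n + k. (ell (n + k - 1 - i + d) / ell (n + k - 1 - i)) ^ (N2 i * q ^ i)) / (ell d :: 'a fls) ^ (q ^ (n + k))"
    unfolding q_def by (rule S_eq_ell[OF le])
  also have "(\<Prod>i<n + k. ((ell (n + k - 1 - i + d) / ell (n + k - 1 - i) :: 'a fls)) ^ (N2 i * q ^ i))
      = (\<Prod>i<n. (ell (n + k - 1 - i + d) / ell (n + k - 1 - i)) ^ (M i * q ^ i)) * ell d ^ ((q - P) * q ^ (n + k - 1))"
    unfolding split using assms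
    by (subst prod.union_disjoint; (subst prod.union_disjoint)?) (auto simp: N2_def)
  also have "(ell d :: 'a fls) ^ (q ^ (n + k)) = ell d ^ ((q - P) * q ^ (n + k - 1)) * ell d ^ (P * q ^ (n + k - 1))"
    unfolding exps by (rule power_add)
  finally show ?thesis by (simp add: P_def q_def)
qed

text \<open>Both power sums have the common numerator \<open>A\<close>, since the index shifts
  \<open>d + k\<close> and \<open>n + k\<close> agree. The extra digit \<open>q - p^m\<close> and
  the inner sum together supply exactly \<open>E^(q^n)\<close>, cancelling the denominator.\<close>

lemma S_shift:
  assumes "n \<ge> 1" "k \<ge> 1" "CHAR('a) ^ m \<le> CARD('a)"
    and N: "\<And>i. i < n \<Longrightarrow> N i = M i + (if i = n - 1 then CARD('a) - CHAR('a) ^ m else 0)"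
    and sum: "(\<Sum>i<n. N i) \<le> CARD('a) - 1"
  shows "S (d + k) (int (CARD('a) ^ n) - (\<Sum>i<n. int (N i * CARD('a) ^ i))) *
      S_less_base k (d + k) ^ (CHAR('a) ^ m * CARD('a) ^ (n - 1)) =
    zeta_ratio n k m N M * S d (int (CHAR('a) ^ m * CARD('a) ^ (n + k - 1)) - (\<Sum>i<n. int (M i * CARD('a) ^ i)))"
proof -
  define P where "P = CHAR('a) ^ m"
  define q where "q = CARD('a)"
  have Pq: "P \<le> q" using assms by (simp add: P_def q_def)
  define E :: "'a fls" where "E = ell (d + k)"
  define A :: "'a fls" where "A = (\<Prod>i<n. ell (n + k - 1 - i + d) ^ (M i * q ^ i))"
  define B :: "'a fls" where "B = (\<Prod>i<n. ell (n - 1 - i) ^ (N i * q ^ i))"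
  define C :: "'a fls" where "C = (\<Prod>i<n. ell (n + k - 1 - i) ^ (M i * q ^ i))"
  define T :: "'a fls" where "T = ell d ^ (P * q ^ (n + k - 1))"
  have nz: "E \<noteq> 0" "B \<noteq> 0" "C \<noteq> 0" "T \<noteq> 0" by (simp_all add: E_def B_def C_def T_def)
  have qn: "q ^ n = q * q ^ (n - 1)" using assms by (cases n) auto
  have exps: "q ^ n = (q - P) * q ^ (n - 1) + P * q ^ (n - 1)"
    using Pq unfolding qn by (simp flip: distrib_right)
  have "(\<Prod>i<n. ell (n - 1 - i + (d + k)) ^ (N i * q ^ i)) =
      (\<Prod>i<n. ell (n + k - 1 - i + d) ^ (M i * q ^ i) * (if i = n - 1 then E ^ ((q - P) * q ^ (n - 1)) else 1))"
  proof (rule prod.cong)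
    fix i assume "i \<in> {..<n}"
    then have i: "i < n" and idx: "n - 1 - i + (d + k) = n + k - 1 - i + d" by auto
    show "ell (n - 1 - i + (d + k)) ^ (N i * q ^ i) =
      ell (n + k - 1 - i + d) ^ (M i * q ^ i) * (if i = n - 1 then E ^ ((q - P) * q ^ (n - 1)) else 1)"
    proof (cases "i = n - 1")
      case True
      then have "ell (n + k - 1 - i + d) = E" using i by (simp add: E_def add.commute)
      then show ?thesis
        unfolding idx N[OF i] using True by (simp add: P_def q_def power_add distrib_right)
    qed (unfold idx N[OF i], simp)
  qed simp
  also have "\<dots> = A * E ^ ((q - P) * q ^ (n - 1))"
    using \<open>n \<ge> 1\<close> by (simp add: prod.distrib A_def)
  finally have num: "(\<Prod>i<n. ell (n - 1 - i + (d + k)) ^ (N i * q ^ i)) = A * E ^ ((q - P) * q ^ (n - 1))" .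
  have "S (d + k) (int (q ^ n) - (\<Sum>i<n. int (N i * q ^ i))) =
      A * E ^ ((q - P) * q ^ (n - 1)) / B / E ^ (q ^ n)"
    using S_eq_ell[OF sum, of "d + k"]
    unfolding q_def[symmetric] power_divide prod_dividef num B_def[symmetric] E_def[symmetric] .
  also have "\<dots> = A / B / E ^ (P * q ^ (n - 1))"
    unfolding exps power_add using nz by simp
  finally have S1: "S (d + k) (int (q ^ n) - (\<Sum>i<n. int (N i * q ^ i))) = A / B / E ^ (P * q ^ (n - 1))" .
  have "q ^ k * (P * q ^ (n - 1)) = P * q ^ (n + k - 1)"
    using \<open>n \<ge> 1\<close> by (simp add: ac_simps flip: power_add)
  then have "((ell d :: 'a fls) ^ (q ^ k)) ^ (P * q ^ (n - 1)) = T"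
    by (simp only: T_def power_mult[symmetric])
  moreover have "S_less_base k (d + k) = telescope_coeff k * E / ell d ^ (q ^ k)"
    by (simp add: S_less_base_def E_def q_def)
  ultimately have S2: "S_less_base k (d + k) ^ (P * q ^ (n - 1)) = telescope_coeff k ^ (P * q ^ (n - 1)) * E ^ (P * q ^ (n - 1)) / T"
    by (simp only: power_divide power_mult_distrib)
  have S3: "S d (int (P * q ^ (n + k - 1)) - (\<Sum>i<n. int (M i * q ^ i))) = A / C / T"
    using S_carry[OF assms(1-3) N sum, of d] unfolding P_def[symmetric] q_def[symmetric] power_divide prod_dividef
      A_def[symmetric] C_def[symmetric] T_def[symmetric] .
  show ?thesis
    unfolding zeta_ratio_def P_def[symmetric] q_def[symmetric] S1 S2 S3 B_def[symmetric] C_def[symmetric]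
    using nz by simp
qed

lemma telescope_coeff_power_eq:
  assumes "n \<ge> 1"
  shows "telescope_coeff k ^ (CHAR('a) ^ m * CARD('a) ^ (n - 1)) =
    ((- 1) ^ k / (\<Prod>j=1..k. bracket j ^ (CHAR('a) ^ m * CARD('a) ^ (n + k - 1 - j))) :: 'a fls)"
proof -
  have "telescope_coeff k ^ (CHAR('a) ^ m * CARD('a) ^ (n - 1)) =
      (\<Prod>j=1..k. - 1 * inverse (bracket j ^ (CHAR('a) ^ m * CARD('a) ^ (n + k - 1 - j))) :: 'a fls)"
    unfolding telescope_coeff_def prod_power_distrib
  proof (rule prod.cong)
    fix j assume "j \<in> {1..k}"
    then have e: "CARD('a) ^ (k - j) * (CHAR('a) ^ m * CARD('a) ^ (n - 1)) = CHAR('a) ^ m * CARD('a) ^ (n + k - 1 - j)"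
      using assms by (simp add: ac_simps flip: power_add)
    have "(- 1 :: 'a fls) ^ (CHAR('a) ^ m * CARD('a) ^ (n + k - 1 - j)) = - 1"
      by (simp only: power_mult minus_one_power_CHAR minus_one_power_q)
    then have "(- (bracket j :: 'a fls)) ^ (CHAR('a) ^ m * CARD('a) ^ (n + k - 1 - j)) =
        - (bracket j ^ (CHAR('a) ^ m * CARD('a) ^ (n + k - 1 - j)))"
      by (subst power_minus) simp
    then show "(inverse (theta - theta ^ CARD('a) ^ j) ^ CARD('a) ^ (k - j)) ^ (CHAR('a) ^ m * CARD('a) ^ (n - 1)) =
      - 1 * inverse (bracket j ^ (CHAR('a) ^ m * CARD('a) ^ (n + k - 1 - j)) :: 'a fls)"
      unfolding power_mult[symmetric] e bracket_conv_theta power_inverse by simp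
  qed simp
  also have "\<dots> = (- 1) ^ k * (\<Prod>j=1..k. inverse (bracket j ^ (CHAR('a) ^ m * CARD('a) ^ (n + k - 1 - j))))"
    unfolding prod.distrib by simp
  finally show ?thesis by (simp add: divide_inverse prod_inversef[symmetric])
qed

text \<open>The factor \<open>q^i\<close> disappears from the sign exponent because q-powers fix
  \<open>- 1\<close>.\<close>

lemma ell_power_eq: "(ell d :: 'a fls) ^ (M * CARD('a) ^ i) = (- 1) ^ (d * M) * L d ^ (M * CARD('a) ^ i)"
proof -
  have "((- 1) ^ d :: 'a fls) ^ (M * CARD('a) ^ i) = ((- 1) ^ (CARD('a) ^ i)) ^ (d * M)"
    by (simp only: power_mult[symmetric] mult_ac)
  then show ?thesis by (simp only: ell_conv_L power_mult_distrib minus_one_power_q)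
qed

lemma zeta_ratio_eq:
  assumes "n \<ge> 1" "CHAR('a) ^ m \<le> CARD('a)"
    and N: "\<And>i. i < n \<Longrightarrow> N i = M i + (if i = n - 1 then CARD('a) - CHAR('a) ^ m else 0)"
  shows "zeta_ratio n k m N M =
    ((- 1) ^ (k * (1 + (\<Sum>i<n. N i))) * (\<Prod>i<n. L (n + k - 1 - i) ^ (M i * CARD('a) ^ i))) /
    ((\<Prod>j=1..k. bracket j ^ (CHAR('a) ^ m * CARD('a) ^ (n + k - 1 - j))) *
      (\<Prod>i<n - 1. L (n - 1 - i) ^ (N i * CARD('a) ^ i)))"
proof -
  \<comment> \<open>Both \<open>(- 1)^q\<close> and \<open>(- 1)^(p^m)\<close> equal
    \<open>- 1\<close>, so replacing the digit \<open>N (n - 1)\<close> by \<open>M (n - 1)\<close>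
    leaves signs unchanged.\<close>
  have "(- 1 :: 'a fls) ^ (CARD('a) - CHAR('a) ^ m) * (- 1) ^ (CHAR('a) ^ m) = (- 1) ^ CARD('a)"
    using assms by (simp flip: power_add)
  then have even: "(- 1 :: 'a fls) ^ (CARD('a) - CHAR('a) ^ m) = 1"
    using minus_one_power_q[of 1] by (simp add: minus_one_power_CHAR)
  have sign: "(- 1 :: 'a fls) ^ ((n + k - 1 - i) * M i) / (- 1) ^ ((n - 1 - i) * N i) = (- 1) ^ (k * N i)"
    if "i < n" for i
  proof (cases "i = n - 1")
    case True
    have "(- 1 :: 'a fls) ^ (k * N i) = (- 1) ^ (k * M i) * ((- 1) ^ (CARD('a) - CHAR('a) ^ m)) ^ k"
      unfolding N[OF that] using True by (simp add: distrib_left power_add mult.commute flip: power_mult)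
    then show ?thesis using True that even by simp
  next
    case False
    then have "(n + k - 1 - i) * M i = k * N i + (n - 1 - i) * N i"
      using that by (simp add: N add.commute flip: distrib_right)
    then show ?thesis by (simp only: power_add) simp
  qed
  have "(\<Prod>i<n. ell (n + k - 1 - i) ^ (M i * CARD('a) ^ i)) / (\<Prod>i<n. ell (n - 1 - i) ^ (N i * CARD('a) ^ i))
      = (\<Prod>i<n. ((- 1) ^ ((n + k - 1 - i) * M i) / (- 1) ^ ((n - 1 - i) * N i)) *
          (L (n + k - 1 - i) ^ (M i * CARD('a) ^ i) / L (n - 1 - i) ^ (N i * CARD('a) ^ i)) :: 'a fls)"
    unfolding ell_power_eq prod_dividef[symmetric] by (simp only: times_divide_times_eq)
  also have "\<dots> = (\<Prod>i<n. (- 1) ^ (k * N i) *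
          (L (n + k - 1 - i) ^ (M i * CARD('a) ^ i) / L (n - 1 - i) ^ (N i * CARD('a) ^ i)))"
    by (intro prod.cong refl) (simp only: sign lessThan_iff)
  also have "\<dots> = (- 1) ^ (k * (\<Sum>i<n. N i)) * ((\<Prod>i<n. L (n + k - 1 - i) ^ (M i * CARD('a) ^ i)) /
      (\<Prod>i<n. L (n - 1 - i) ^ (N i * CARD('a) ^ i)))"
    by (simp add: prod.distrib prod_dividef power_sum sum_distrib_left)
  \<comment> \<open>The last factor is a power of \<open>L 0 = 1\<close>.\<close>
  also have "(\<Prod>i<n. L (n - 1 - i) ^ (N i * CARD('a) ^ i)) =
      (\<Prod>i<n - 1. L (n - 1 - i) ^ (N i * CARD('a) ^ i) :: 'a fls)"
    using \<open>n \<ge> 1\<close> by (cases n) (simp_all add: L_def[of 0])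
  finally show ?thesis
    unfolding zeta_ratio_def telescope_coeff_power_eq[OF \<open>n \<ge> 1\<close>] by (simp add: distrib_left power_add)
qed

lemma zeta_ratio_nonzero: "zeta_ratio n k m N M \<noteq> 0"
  using theta_diff_nonzero[where 'a='a] by (auto simp: zeta_ratio_def telescope_coeff_def)

lemma zeta_ratio_in_K_field: "zeta_ratio n k m N M \<in> K_field"
  unfolding zeta_ratio_def
  by (intro K_field_mult K_field_divide K_field_prod K_field_power K_field_ell K_field_telescope_coeff)

lemma multizeta_eq_zeta_ratio:
  assumes "n \<ge> 1" "k \<ge> 1" "CHAR('a) ^ m \<le> CARD('a)"
    and N: "\<And>i. i < n \<Longrightarrow> N i = M i + (if i = n - 1 then CARD('a) - CHAR('a) ^ m else 0)"
    and sum: "(\<Sum>i<n. N i) \<le> CARD('a) - 1"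
    and s1: "s1 = int (CARD('a) ^ n) - (\<Sum>i<n. int (N i * CARD('a) ^ i))" "s1 > 0"
    and w: "w = int (CHAR('a) ^ m * CARD('a) ^ (n + k - 1)) - (\<Sum>i<n. int (M i * CARD('a) ^ i))" "w > 0"
  shows "multizeta (s1 # map (\<lambda>e. int (CHAR('a) ^ m * (CARD('a) - 1) * CARD('a) ^ e)) [n - 1..<n - 1 + k])
    = zeta_ratio n k m N M * (zeta w :: 'a fls)"
proof (rule multizeta_eq_mult_zeta[where k=k])
  have "CHAR('a) > 0" by (rule prime_gt_0_nat[OF finite_field_prime_CHAR])
  then have "0 < int (CHAR('a) ^ m * (CARD('a) - 1) * CARD('a) ^ e)" for e
    using CARD_gt_1[where 'a='a] by simp
  then show "\<forall>s\<in>set (s1 # map (\<lambda>e. int (CHAR('a) ^ m * (CARD('a) - 1) * CARD('a) ^ e)) [n - 1..<n - 1 + k]). 0 < s"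
    using s1(2) by auto
  have "S_less_base k d ^ (CHAR('a) ^ m * CARD('a) ^ (n - 1)) = (0 :: 'a fls)" if "d < k" for d
    using that \<open>CHAR('a) > 0\<close> by (simp add: S_less_base_def power_0_left)
  then show "S d s1 * S_less (map (\<lambda>e. int (CHAR('a) ^ m * (CARD('a) - 1) * CARD('a) ^ e)) [n - 1..<n - 1 + k]) d
      = (0 :: 'a fls)" if "d < k" for d
    unfolding S_less_eq_base using that by simp
  show "S (d + k) s1 * S_less (map (\<lambda>e. int (CHAR('a) ^ m * (CARD('a) - 1) * CARD('a) ^ e)) [n - 1..<n - 1 + k]) (d + k)
      = zeta_ratio n k m N M * (S d w :: 'a fls)" for d
    unfolding S_less_eq_base s1(1) w(1) using assms(1-5) by (rule S_shift)
qed (use w(2) zeta_ratio_nonzero in auto)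

end

section \<open>Digits of \<open>s1\<close> and \<open>w\<close>, and evaluation of the ratio\<close>

theorem theorem4p5:
  fixes p l q n r m :: nat and N :: "nat \<Rightarrow> nat"
    and s1 w :: int and ss :: "int list" and N' :: "nat \<Rightarrow> int"
  assumes "prime p" and "q = p ^ l" and "q > 2" and "CARD('a::{field,finite}) = q"
    and "n \<ge> 1" and "r \<ge> 2" and "p ^ m \<le> q"
    and "1 \<le> (\<Sum>i<n. N i)" and "(\<Sum>i<n. N i) \<le> q - 1"
    and s1_def: "s1 = int (q ^ n) - (\<Sum>i<n. int (N i * q ^ i))"
    and "(int q - 1) * s1 \<le> int (p ^ m * (q - 1) * q ^ (n - 1))"
    and ss_def: "ss = s1 # map (\<lambda>e. int (p ^ m * (q - 1) * q ^ e)) [n - 1..<n + r - 2]"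
    and w_def: "w = int (p ^ m * q ^ (n + r - 2)) - int (p ^ m * q ^ (n - 1)) + s1"
    and N'_def: "\<And>i. N' i = (if i = n - 1 then int (N i) - (int q - int (p ^ m)) else int (N i))"
  shows "zeta_like TYPE('a) ss \<and>
    (\<not> (int q - 1) dvd s1 \<longrightarrow>
      (multizeta ss :: 'a fls) =
        ((- 1) ^ ((r - 1) * (1 + (\<Sum>i<n. N i))) *
           (\<Prod>i<n. L (n + r - 2 - i) powi (N' i * int (q ^ i)))) /
        ((\<Prod>k=1..r - 1. bracket k ^ (p ^ m * q ^ (n + r - 2 - k))) *
           (\<Prod>i<n - 1. L (n - 1 - i) ^ (N i * q ^ i))) *
        zeta w)"
proof -
  \<comment> \<open>The characteristic divides \<open>q = p^l\<close> and is prime, hence equals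
    \<open>p\<close>.\<close>
  have "of_nat q = (0 :: 'a)" using of_nat_CARD_eq_0[where 'a='a] assms(4) by simp
  then have "CHAR('a) dvd p ^ l" using assms(2) by (simp only: of_nat_eq_0_iff_char_dvd)
  then have "CHAR('a) dvd p"
    using finite_field_prime_CHAR[where 'a='a] by (rule prime_dvd_power[rotated])
  then have char: "CHAR('a) = p"
    using finite_field_prime_CHAR[where 'a='a] assms(1) by (simp add: primes_dvd_imp_eq)
  have q: "CARD('a) = q" by fact
  interpret finite_constants l "TYPE('a)"
    by unfold_locales (simp add: q char assms(2))
  have q0: "q > 0" and p0: "p > 0" using assms(1,3) by (auto simp: prime_gt_0_nat)
  have nn: "Suc (n - 1) = n" and qn: "q ^ n = q * q ^ (n - 1)" using \<open>n \<ge> 1\<close> by (cases n; simp)+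
  define P where "P = p ^ m"
  define k where "k = r - 1"
  have k: "k \<ge> 1" "n - 1 + k = n + r - 2" "n + k - 1 = n + r - 2"
    using \<open>r \<ge> 2\<close> \<open>n \<ge> 1\<close> by (simp_all add: k_def)
  have Pq: "P \<le> q" using assms(7) by (simp add: P_def)
  define W where "W = (\<Sum>i<n. N i * q ^ i)"
  have s1W: "s1 = int (q ^ n) - int W" by (simp add: s1_def W_def)
  \<comment> \<open>Moving all digits to position \<open>n - 1\<close> bounds \<open>W\<close> by
    \<open>(q - 1) q^(n - 1) < q^n\<close>, which makes \<open>s1\<close> positive.\<close>
  have "W \<le> (\<Sum>i<n. N i * q ^ (n - 1))"
    unfolding W_def using q0 by (intro sum_mono mult_left_mono power_increasing) auto
  also have "\<dots> = (\<Sum>i<n. N i) * q ^ (n - 1)" by (simp add: sum_distrib_right)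
  also have "\<dots> \<le> (q - 1) * q ^ (n - 1)" using assms(9) by (intro mult_right_mono) auto
  also have "\<dots> < q ^ n" unfolding qn using q0 by (intro mult_strict_right_mono) auto
  finally have s1_pos: "s1 > 0" unfolding s1W by linarith
  have s1_le: "s1 \<le> int (P * q ^ (n - 1))"
  proof -
    have "(int q - 1) * s1 \<le> (int q - 1) * int (P * q ^ (n - 1))"
      using assms(11) q0 by (simp add: P_def of_nat_diff mult_ac)
    then show ?thesis using \<open>q > 2\<close> by (simp add: mult_le_cancel_left)
  qed
  \<comment> \<open>The bound on \<open>s1\<close> says \<open>W \<ge> (q - P) q^(n - 1)\<close>.
    Lower digits contribute less than \<open>q^(n - 1)\<close>, so the top digit alone must reach
    \<open>q - P\<close>.\<close>
  have carry: "q - P \<le> N (n - 1)"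
  proof (rule ccontr)
    assume neg: "\<not> q - P \<le> N (n - 1)"
    have "W = (\<Sum>i<n - 1. N i * q ^ i) + N (n - 1) * q ^ (n - 1)"
      unfolding W_def by (subst nn[symmetric], subst sum.lessThan_Suc) simp
    \<comment> \<open>The case \<open>n = 1\<close> is separate because \<open>n - 2\<close> would
      be truncated.\<close>
    moreover have "(\<Sum>i<n - 1. N i * q ^ i) < q ^ (n - 1)"
    proof (cases "n = 1")
      case True
      then show ?thesis by simp
    next
      case False
      then have n2: "q ^ (n - 1) = q * q ^ (n - 2)" using \<open>n \<ge> 1\<close> by (simp flip: power_Suc add: Suc_diff_Suc numeral_2_eq_2)
      have "(\<Sum>i<n - 1. N i * q ^ i) \<le> (\<Sum>i<n - 1. N i * q ^ (n - 2))"
        using q0 by (intro sum_mono mult_left_mono power_increasing) auto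
      also have "\<dots> = (\<Sum>i<n - 1. N i) * q ^ (n - 2)" by (simp add: sum_distrib_right)
      also have "\<dots> \<le> (\<Sum>i<n. N i) * q ^ (n - 2)"
        by (intro mult_right_mono sum_mono2) auto
      also have "\<dots> \<le> (q - 1) * q ^ (n - 2)" using assms(9) by (intro mult_right_mono) auto
      also have "\<dots> < q ^ (n - 1)" unfolding n2 using q0 by (intro mult_strict_right_mono) auto
      finally show ?thesis .
    qed
    moreover have "Suc (N (n - 1)) * q ^ (n - 1) \<le> (q - P) * q ^ (n - 1)"
      using neg by (intro mult_right_mono) auto
    ultimately have "W < (q - P) * q ^ (n - 1)" by simp
    moreover have "(q - P) * q ^ (n - 1) + P * q ^ (n - 1) = q ^ n"
      unfolding qn using Pq by (simp flip: distrib_right)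
    ultimately have "int W + int (P * q ^ (n - 1)) < int (q ^ n)" by linarith
    then show False using s1_le s1W by linarith
  qed
  \<comment> \<open>By \<open>carry\<close> the natural subtraction is exact, so \<open>M\<close>
    represents the integer digits \<open>N'\<close>.\<close>
  define M where "M i = (if i = n - 1 then N i - (q - P) else N i)" for i
  have NM: "N i = M i + (if i = n - 1 then CARD('a) - CHAR('a) ^ m else 0)" for i
    using carry by (simp add: M_def q char P_def)
  have N'M: "N' i = int (M i)" for i
    using carry Pq by (simp add: N'_def M_def P_def of_nat_diff)
  have "W = (\<Sum>i<n. M i * q ^ i + (if i = n - 1 then (q - P) * q ^ (n - 1) else 0))"
    unfolding W_def by (intro sum.cong refl, subst NM) (simp add: distrib_right q char P_def)
  also have "\<dots> = (\<Sum>i<n. M i * q ^ i) + (q - P) * q ^ (n - 1)"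
    using \<open>n \<ge> 1\<close> by (simp add: sum.distrib)
  finally have "int W = (\<Sum>i<n. int (M i * q ^ i)) + (int (q ^ n) - int (P * q ^ (n - 1)))"
    unfolding qn using Pq by (simp add: of_nat_diff left_diff_distrib)
  then have w: "w = int (P * q ^ (n + k - 1)) - (\<Sum>i<n. int (M i * q ^ i))"
    unfolding w_def k(3) s1W P_def by simp
  have w_pos: "w > 0"
  proof -
    have "p ^ m * q ^ (n - 1) \<le> p ^ m * q ^ (n + r - 2)"
      using q0 \<open>r \<ge> 2\<close> by (intro mult_left_mono power_increasing) auto
    then have "int (p ^ m * q ^ (n - 1)) \<le> int (p ^ m * q ^ (n + r - 2))" by (simp only: of_nat_le_iff)
    then show ?thesis unfolding w_def using s1_pos by linarith
  qed
  have eq: "multizeta ss = zeta_ratio n k m N M * (zeta w :: 'a fls)"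
    unfolding ss_def k(2)[symmetric]
    by (rule multizeta_eq_zeta_ratio[unfolded q char])
      (use assms(5,7,9) k(1) NM[unfolded q char] s1_def s1_pos w[unfolded P_def] w_pos in auto)
  have "sum_list ss = w"
  proof -
    have "sum_list (map (\<lambda>e. int (p ^ m * (q - 1) * q ^ e)) [b..<b + j])
        = int (p ^ m * q ^ (b + j)) - int (p ^ m * q ^ b)" for b j
      using q0 by (induction j) (simp_all add: of_nat_diff algebra_simps)
    from this[of "n - 1" k] show ?thesis unfolding ss_def w_def k(2) by simp
  qed
  \<comment> \<open>If \<open>zeta w\<close> were 0, the quotient would be 0 by convention and still
    lie in \<open>K_field\<close>.\<close>
  moreover have "zeta_ratio n k m N M * (zeta w :: 'a fls) / zeta w \<in> K_field"
    using zeta_ratio_in_K_field by (cases "zeta w = (0 :: 'a fls)") simp_all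
  ultimately have "zeta_like TYPE('a) ss" unfolding zeta_like_def eq by simp
  moreover have "zeta_ratio n k m N M =
      ((- 1) ^ ((r - 1) * (1 + (\<Sum>i<n. N i))) *
         (\<Prod>i<n. L (n + r - 2 - i) powi (N' i * int (q ^ i)))) /
      ((\<Prod>k=1..r - 1. bracket k ^ (p ^ m * q ^ (n + r - 2 - k))) *
         (\<Prod>i<n - 1. L (n - 1 - i) ^ (N i * q ^ i)))"
  proof -
    have "L (n + r - 2 - i) powi (N' i * int (q ^ i)) = (L (n + r - 2 - i) :: 'a fls) ^ (M i * q ^ i)" for i
      unfolding N'M of_nat_mult[symmetric] power_int_of_nat ..
    moreover have "zeta_ratio n k m N M =
        ((- 1) ^ (k * (1 + (\<Sum>i<n. N i))) * (\<Prod>i<n. L (n + k - 1 - i) ^ (M i * q ^ i))) /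
        ((\<Prod>j=1..k. bracket j ^ (p ^ m * q ^ (n + k - 1 - j))) *
          (\<Prod>i<n - 1. L (n - 1 - i) ^ (N i * q ^ i)))"
      using zeta_ratio_eq[unfolded q char, of n m N M k] assms(5,7) NM[unfolded q char] by blast
    ultimately show ?thesis by (simp only: k(3) k_def[symmetric])
  qed
  ultimately show ?thesis using eq by simp
qed

end
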